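(* Let $f,g_1,\ldots,g_m\in\mathbb{R}[\mathbf{x}]$ with $\mathbf{x}=(x_1,\ldots,x_d)$ and $\deg(f)\geq 2$, let $\mathbf{K}:=\{\mathbf{x}\in\mathbb{R}^d: g_j(\mathbf{x})\geq 0,\ j=1,\ldots,m\}$, and consider the polynomial optimization problem $\mathbf{P}:\ f^*=\min_{\mathbf{x}}\{f(\mathbf{x}):\mathbf{x}\in\mathbf{K}\}$. Let $d_j:=\lceil\deg(g_j)/2\rceil$ for $j=1,\ldots,m$ and $v:=\max\{d_1,\ldots,d_m\}$. Let $n$ be such that $n\geq v$ and $2n-1\geq\deg(f)$, and let $\boldsymbol{\phi}^n=(\phi^n_{\boldsymbol{\alpha}})_{\boldsymbol{\alpha}\in\mathbb{N}^d_{2n}}$ be an optimal solution of the degree-$n$ semidefinite relaxation $\mathbf{Q}_n$ of $\mathbf{P}$, whose optimal value is $\rho_n$ and whose definition is recalled in the context. (i) If $s:=\mathrm{rank}(\mathbf{M}_n(\boldsymbol{\phi}^n))\leq n-v+1$, then $\phi^n(f)=f^*$, that is, $\rho_n=f^*$ and the relaxation $\mathbf{Q}_n$ is exact. Moreover, $\boldsymbol{\phi}^{\hat n}:=(\phi^n_{\boldsymbol{\alpha}})_{\boldsymbol{\alpha}\in\mathbb{N}^d_{2n-1}}$ has a representing measure supported on at most $s$ global minimizers of $\mathbf{P}$. (ii) Assume in addition (to the rank condition in (i)) that $\deg(f)\leq 2$ and $\deg(g_j)\leq 2$ for all $j$, so that $v=1$ (and $\mathbf{P}$ is a quadratically constrained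 quadratic problem). Then one may exhibit a probability measure supported on global minimizers of $\mathbf{P}$.
   Context: Notation: $\mathbb{N}^d_k:=\{\boldsymbol{\alpha}\in\mathbb{N}^d: |\boldsymbol{\alpha}|=\sum_i\alpha_i\leq k\}$; $\mathbb{R}[\mathbf{x}]_k$ is the space of real polynomials in $d$ variables of degree at most $k$. Riesz functional: for a real sequence $\boldsymbol{\phi}=(\phi_{\boldsymbol{\alpha}})_{\boldsymbol{\alpha}\in\mathbb{N}^d_{2n}}$, the Riesz functional $\phi:\mathbb{R}[\mathbf{x}]_{2n}\to\mathbb{R}$ is the linear map $p=\sum_{\boldsymbol{\alpha}}p_{\boldsymbol{\alpha}}\mathbf{x}^{\boldsymbol{\alpha}}\mapsto \phi(p)=\sum_{\boldsymbol{\alpha}}p_{\boldsymbol{\alpha}}\phi_{\boldsymbol{\alpha}}$. Moment matrix: $\mathbf{M}_n(\boldsymbol{\phi})$ is the real symmetric matrix with rows and columns indexed by $\mathbb{N}^d_n$ and entries $\phi_{\boldsymbol{\alpha}+\boldsymbol{\beta}}$. Localizing matrix: for $g=\sum_{\boldsymbol{\gamma}}g_{\boldsymbol{\gamma}}\mathbf{x}^{\boldsymbol{\gamma}}$, $\mathbf{M}_k(g\,\boldsymbol{\phi})$ is the real symmetric matrix with rows and columns indexed by $\mathbb{N}^d_k$ and entries $\sum_{\boldsymbol{\gamma}}g_{\boldsymbol{\gamma}}\phi_{\boldsymbol{\alpha}+\boldsymbol{\beta}+\boldsymbol{\gamma}}$. $\mathbf{B}\succeq0$ means that $\mathbf{B}$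 is positive semidefinite. A sequence $(\phi_{\boldsymbol{\alpha}})_{\boldsymbol{\alpha}\in\mathbb{N}^d_k}$ has a representing measure if there is a (positive Borel) measure $\mu$ on $\mathbb{R}^d$ with $\phi_{\boldsymbol{\alpha}}=\int\mathbf{x}^{\boldsymbol{\alpha}}\,d\mu$ for all $\boldsymbol{\alpha}\in\mathbb{N}^d_k$. Semidefinite relaxation: with $g_0:=1$ and $d_0:=0$ (so that $\mathbf{M}_{n-d_0}(g_0\,\boldsymbol{\phi})=\mathbf{M}_n(\boldsymbol{\phi})$), $$\mathbf{Q}_n:\quad \rho_n=\min_{\boldsymbol{\phi}}\{\phi(f):\ \phi(1)=1;\ \mathbf{M}_{n-d_j}(g_j\,\boldsymbol{\phi})\succeq0,\ j=0,\ldots,m\},$$ where the minimum is over real sequences $\boldsymbol{\phi}=(\phi_{\boldsymbol{\alpha}})_{\boldsymbol{\alpha}\in\mathbb{N}^d_{2n}}$. $\mathbf{Q}_n$ is called exact if $\rho_n=f^*$. *)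

theory Defs
  imports
    "HOL-Analysis.Analysis"
    "HOL-Analysis.Finite_Function_Topology"
    "HOL-Probability.Probability_Measure"
    "HOL-Library.Poly_Mapping"
begin

text \<open>
  The number of variables is \<open>CARD('d)\<close>. Multi-indices and real polynomials are finitely
  supported functions; on polynomials, \<open>+\<close>, \<open>*\<close>, \<open>1\<close> from Poly_Mapping are the polynomial
  operations (convolution product), and the real vector space structure on finitely supported
  functions is that of Finite_Function_Topology.
\<close>

type_synonym 'd mindex = "'d \<Rightarrow>\<^sub>0 nat"
type_synonym 'd rpoly = "'d mindex \<Rightarrow>\<^sub>0 real"
type_synonym 'd mseq = "'d mindex \<Rightarrow> real"

definition mabs :: "'d::finite mindex \<Rightarrow> nat" where
  "mabs \<alpha> = (\<Sum>i\<in>UNIV. Poly_Mapping.lookup \<alpha> i)"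

definition mindices :: "nat \<Rightarrow> 'd::finite mindex set" where
  "mindices k = {\<alpha>. mabs \<alpha> \<le> k}"

definition monom_val :: "'d::finite mindex \<Rightarrow> real ^ 'd \<Rightarrow> real" where
  "monom_val \<alpha> x = (\<Prod>i\<in>UNIV. (x $ i) ^ Poly_Mapping.lookup \<alpha> i)"

definition poly_val :: "'d::finite rpoly \<Rightarrow> real ^ 'd \<Rightarrow> real" where
  "poly_val p x = (\<Sum>\<alpha>\<in>Poly_Mapping.keys p. Poly_Mapping.lookup p \<alpha> * monom_val \<alpha> x)"

text \<open>The zero polynomial gets degree 0.\<close>

definition tdeg :: "'d::finite rpoly \<Rightarrow> nat" where
  "tdeg p = Max (insert 0 (mabs ` Poly_Mapping.keys p))"

definition half_deg :: "'d::finite rpoly \<Rightarrow> nat" where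
  "half_deg p = nat \<lceil>real (tdeg p) / 2\<rceil>"

definition feasible_set :: "nat \<Rightarrow> (nat \<Rightarrow> 'd::finite rpoly) \<Rightarrow> (real ^ 'd) set" where
  "feasible_set m g = {x. \<forall>j\<in>{1..m}. 0 \<le> poly_val (g j) x}"

text \<open>
  The optimal value is taken in the extended reals, so that it makes sense without assuming that
  the feasible set is nonempty or that the minimum is attained.
\<close>

definition opt_value :: "'d::finite rpoly \<Rightarrow> nat \<Rightarrow> (nat \<Rightarrow> 'd rpoly) \<Rightarrow> ereal" where
  "opt_value f m g = (INF x\<in>feasible_set m g. ereal (poly_val f x))"

definition global_minimizers :: "'d::finite rpoly \<Rightarrow> nat \<Rightarrow> (nat \<Rightarrow> 'd rpoly) \<Rightarrow> (real ^ 'd) set" where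
  "global_minimizers f m g = {x. is_arg_min (poly_val f) (\<lambda>y. y \<in> feasible_set m g) x}"

text \<open>
  A sequence indexed by \<open>mindices (2 * n)\<close> is represented by a total function of which only the
  values on \<open>mindices (2 * n)\<close> are ever used.
\<close>

definition riesz :: "'d::finite mseq \<Rightarrow> 'd rpoly \<Rightarrow> real" where
  "riesz \<phi> p = (\<Sum>\<alpha>\<in>Poly_Mapping.keys p. Poly_Mapping.lookup p \<alpha> * \<phi> \<alpha>)"

text \<open>Matrices are functions of a row and a column index, used together with a finite index set.\<close>

definition moment_mat :: "'d::finite mseq \<Rightarrow> 'd mindex \<Rightarrow> 'd mindex \<Rightarrow> real" where
  "moment_mat \<phi> \<alpha> \<beta> = \<phi> (\<alpha> + \<beta>)"

definition localizing_mat :: "'d::finite rpoly \<Rightarrow> 'd mseq \<Rightarrow> 'd mindex \<Rightarrow> 'd mindex \<Rightarrow> real" where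
  "localizing_mat q \<phi> \<alpha> \<beta> =
     (\<Sum>\<gamma>\<in>Poly_Mapping.keys q. Poly_Mapping.lookup q \<gamma> * \<phi> (\<alpha> + \<beta> + \<gamma>))"

definition psd_on :: "'i set \<Rightarrow> ('i \<Rightarrow> 'i \<Rightarrow> real) \<Rightarrow> bool" where
  "psd_on I A \<longleftrightarrow>
     (\<forall>\<alpha>\<in>I. \<forall>\<beta>\<in>I. A \<alpha> \<beta> = A \<beta> \<alpha>) \<and>
     (\<forall>v :: 'i \<Rightarrow> real. 0 \<le> (\<Sum>\<alpha>\<in>I. \<Sum>\<beta>\<in>I. v \<alpha> * A \<alpha> \<beta> * v \<beta>))"

definition column_on :: "'i set \<Rightarrow> ('i \<Rightarrow> 'i \<Rightarrow> real) \<Rightarrow> 'i \<Rightarrow> 'i \<Rightarrow>\<^sub>0 real" where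
  "column_on I A \<beta> = (\<Sum>\<alpha>\<in>I. Poly_Mapping.single \<alpha> (A \<alpha> \<beta>))"

definition rank_on :: "'i set \<Rightarrow> ('i \<Rightarrow> 'i \<Rightarrow> real) \<Rightarrow> nat" where
  "rank_on I A = dim (column_on I A ` I)"

text \<open>
  Putting \<open>1\<close> in place of \<open>g 0\<close> makes the constraint for \<open>j = 0\<close> the one on the moment matrix.
\<close>

definition relax_feasible :: "nat \<Rightarrow> nat \<Rightarrow> (nat \<Rightarrow> 'd::finite rpoly) \<Rightarrow> 'd mseq \<Rightarrow> bool" where
  "relax_feasible n m g \<phi> \<longleftrightarrow>
     riesz \<phi> 1 = 1 \<and>
     (\<forall>j\<in>{0..m}. psd_on (mindices (n - half_deg ((g(0 := 1)) j)))
                        (localizing_mat ((g(0 := 1)) j) \<phi>))"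

definition relax_value :: "nat \<Rightarrow> 'd::finite rpoly \<Rightarrow> nat \<Rightarrow> (nat \<Rightarrow> 'd rpoly) \<Rightarrow> ereal" where
  "relax_value n f m g = (INF \<phi>\<in>{\<phi>. relax_feasible n m g \<phi>}. ereal (riesz \<phi> f))"

definition relax_optimal ::
    "nat \<Rightarrow> 'd::finite rpoly \<Rightarrow> nat \<Rightarrow> (nat \<Rightarrow> 'd rpoly) \<Rightarrow> 'd mseq \<Rightarrow> bool" where
  "relax_optimal n f m g \<phi> \<longleftrightarrow> is_arg_min (\<lambda>\<psi>. riesz \<psi> f) (relax_feasible n m g) \<phi>"

definition relax_exact :: "nat \<Rightarrow> 'd::finite rpoly \<Rightarrow> nat \<Rightarrow> (nat \<Rightarrow> 'd rpoly) \<Rightarrow> bool" where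
  "relax_exact n f m g \<longleftrightarrow> relax_value n f m g = opt_value f m g"

definition represents :: "(real ^ 'd::finite) measure \<Rightarrow> nat \<Rightarrow> 'd mseq \<Rightarrow> bool" where
  "represents \<mu> k \<phi> \<longleftrightarrow>
     sets \<mu> = sets borel \<and>
     (\<forall>\<alpha>\<in>mindices k. integrable \<mu> (monom_val \<alpha>) \<and> \<phi> \<alpha> = (\<integral>x. monom_val \<alpha> x \<partial>\<mu>))"

text \<open>
  Only used for finite \<open>S\<close> and for sets of global minimizers, which are closed; for closed \<open>S\<close> this
  says that the topological support of \<open>\<mu>\<close> is contained in \<open>S\<close>.
\<close>

definition supported_on :: "(real ^ 'd::finite) measure \<Rightarrow> (real ^ 'd) set \<Rightarrow> bool" where
  "supported_on \<mu> S \<longleftrightarrow> (AE x in \<mu>. x \<in> S)"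

text \<open>The maximum over \<open>j = 1, ..., m\<close>; including \<open>0\<close> only matters when \<open>m = 0\<close>.\<close>

definition max_half_deg :: "nat \<Rightarrow> (nat \<Rightarrow> 'd::finite rpoly) \<Rightarrow> nat" where
  "max_half_deg m g = Max (insert 0 ((\<lambda>j. half_deg (g j)) ` {1..m}))"

end

theory Submission
  imports Defs "HOL-Computational_Algebra.Fundamental_Theorem_Algebra"
begin

text \<open>
  The form \<open>(p, q) \<mapsto> \<phi>(p q)\<close> is positive semidefinite on polynomials of degree at most \<open>n\<close>. If its
  rank is at most \<open>n - v + 1\<close>, the ranks of its restrictions to degree at most \<open>k\<close> must stall early
  enough that multiplication by the coordinates induces commuting symmetric operators modulo the
  radical. (For \<open>v = 0\<close> the ranks may instead be exactly \<open>1, 2, ..., n + 1\<close>; then \<open>\<phi>\<close> lives on a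
  line, and the operators are affine functions of a single one, as in Gauss quadrature.) The joint
  eigenvalues of these operators are the atoms of a measure representing \<open>\<phi>\<close> up to degree
  \<open>2 n - 1\<close>. Testing the localizing matrix of \<open>g\<^sub>j\<close> on a low-degree representative of a joint
  eigenvector gives the value of \<open>g\<^sub>j\<close> at the atom, so the atoms are feasible. Moment sequences of
  feasible points are feasible for the relaxation, hence \<open>\<phi>(f) \<le> f\<close> on the feasible set; as \<open>\<phi>(f)\<close>
  is a convex combination with positive weights of the values at the atoms, all of these are equal
  to \<open>\<phi>(f)\<close>.
\<close>

section \<open>Simultaneous diagonalization modulo a radical\<close>

text \<open>Horner evaluation of \<open>p(T) v\<close>. The vector is an argument, so that no
  algebra of operators has to be set up.\<close>

definition poly_apply :: "('a::real_vector \<Rightarrow> 'a) \<Rightarrow> real poly \<Rightarrow> 'a \<Rightarrow> 'a" where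
  "poly_apply T p v = fold_coeffs (\<lambda>c u. c *\<^sub>R v + T u) p 0"

lemma poly_apply_0 [simp]: "poly_apply T 0 v = 0"
  by (simp add: poly_apply_def)

lemma poly_apply_pCons:
  assumes "linear T"
  shows "poly_apply T (pCons c p) v = c *\<^sub>R v + T (poly_apply T p v)"
  using linear_0[OF assms] by (cases "p = 0 \<and> c = 0") (auto simp: poly_apply_def)

lemma poly_apply_add:
  assumes "linear T"
  shows "poly_apply T (p + q) v = poly_apply T p v + poly_apply T q v"
  by (induction p q rule: poly_induct2)
     (simp_all add: poly_apply_pCons[OF assms] linear_add[OF assms] scaleR_add_left)

lemma poly_apply_smult:
  assumes "linear T"
  shows "poly_apply T (smult c p) v = c *\<^sub>R poly_apply T p v"
  by (induction p)
     (simp_all add: poly_apply_pCons[OF assms] linear_scale[OF assms] scaleR_add_right)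

lemma poly_apply_diff:
  assumes "linear T"
  shows "poly_apply T (p - q) v = poly_apply T p v - poly_apply T q v"
  using poly_apply_add[OF assms, of "p - q" q v] by simp

lemma poly_apply_monom:
  assumes "linear T"
  shows "poly_apply T (monom c j) v = c *\<^sub>R (T ^^ j) v"
  by (induction j)
     (simp_all add: monom_0 monom_Suc poly_apply_pCons[OF assms] linear_scale[OF assms]
       linear_0[OF assms])

lemma poly_apply_sum:
  assumes "linear T"
  shows "poly_apply T (\<Sum>j\<in>J. p j) v = (\<Sum>j\<in>J. poly_apply T (p j) v)"
  by (induction J rule: infinite_finite_induct) (simp_all add: poly_apply_add[OF assms])

lemma poly_apply_in_subspace:
  assumes "linear T" "subspace W" "T ` W \<subseteq> W" "v \<in> W"
  shows "poly_apply T p v \<in> W"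
proof (induction p)
  case (pCons c p)
  then show ?case
    using assms by (auto simp: poly_apply_pCons intro!: subspace_add subspace_scale)
qed (simp add: subspace_0 assms)

text \<open>Stated for a family rather than a set: a repeated vector gives the relation
  \<open>x i - x j = 0\<close>, and otherwise \<open>card F + 1\<close> distinct vectors in
  \<open>span F\<close> are dependent.\<close>

lemma linear_relation_in_span:
  fixes x :: "nat \<Rightarrow> 'a::real_vector"
  assumes "finite F" "\<And>j. x j \<in> span F"
  obtains c where "\<exists>j\<le>card F. c j \<noteq> 0" "(\<Sum>j\<le>card F. c j *\<^sub>R x j) = 0"
proof (cases "inj_on x {..card F}")
  case False
  then obtain i j where ij: "i \<le> card F" "j \<le> card F" "i \<noteq> j" "x i = x j"
    by (auto simp: inj_on_def)
  define c :: "nat \<Rightarrow> real" where "c k = (if k = i then 1 else if k = j then -1 else 0)" for k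
  have "(\<Sum>k\<le>card F. c k *\<^sub>R x k) = (\<Sum>k\<in>{i, j}. c k *\<^sub>R x k)"
    using ij by (intro sum.mono_neutral_right) (auto simp: c_def)
  also have "\<dots> = 0"
    using ij by (simp add: c_def)
  finally have "(\<Sum>k\<le>card F. c k *\<^sub>R x k) = 0" .
  moreover have "c i \<noteq> 0" by (simp add: c_def)
  ultimately show ?thesis using ij that by blast
next
  case True
  let ?S = "x ` {..card F}"
  have "card ?S = Suc (card F)"
    using True by (simp add: card_image)
  then have "dependent ?S"
    using independent_span_bound[of F ?S] assms by fastforce
  then obtain u where u: "\<exists>v\<in>?S. u v \<noteq> 0" "(\<Sum>v\<in>?S. u v *\<^sub>R v) = 0"
    by (auto simp: dependent_finite)
  then have "(\<Sum>j\<le>card F. u (x j) *\<^sub>R x j) = 0"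
    using True by (simp add: sum.reindex)
  with u that[of "u \<circ> x"] show ?thesis by auto
qed

lemma annihilating_poly:
  fixes T :: "'a::real_vector \<Rightarrow> 'a"
  assumes "linear T" "finite F" "\<And>j. (T ^^ j) v \<in> span F"
  obtains q where "q \<noteq> 0" "poly_apply T q v = 0"
proof -
  obtain c where c: "\<exists>j\<le>card F. c j \<noteq> 0" "(\<Sum>j\<le>card F. c j *\<^sub>R (T ^^ j) v) = 0"
    using linear_relation_in_span[OF assms(2), of "\<lambda>j. (T ^^ j) v"] assms(3) by metis
  let ?q = "\<Sum>j\<le>card F. monom (c j) j"
  have "poly_apply T ?q v = 0"
    using c(2) by (simp add: poly_apply_sum poly_apply_monom assms(1))
  moreover obtain j where "j \<le> card F" "c j \<noteq> 0"
    using c(1) by blast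
  then have "coeff ?q j \<noteq> 0"
    by (simp add: coeff_sum)
  then have "?q \<noteq> 0" by (metis coeff_0)
  ultimately show ?thesis using that by blast
qed

section \<open>Real factors from complex roots\<close>

lemma poly_map_of_real_add:
  "poly (map_poly of_real (p + q)) z =
    poly (map_poly of_real p) z + poly (map_poly of_real q) (z::complex)"
  by (induction p q rule: poly_induct2) (simp_all add: map_poly_pCons algebra_simps)

lemma poly_map_of_real_mult:
  "poly (map_poly of_real (p * q)) z =
    poly (map_poly of_real p) z * poly (map_poly of_real q) (z::complex)"
proof (induction p)
  case (pCons c p)
  have "poly (map_poly of_real (smult c q)) z = of_real c * poly (map_poly of_real q) z"
    by (induction q) (simp_all add: map_poly_pCons algebra_simps)
  with pCons show ?case
    by (simp add: poly_map_of_real_add map_poly_pCons algebra_simps)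
qed simp

lemma poly_map_of_real_of_real:
  "poly (map_poly of_real p) (of_real x :: complex) = of_real (poly p x)"
  by (induction p) (simp_all add: map_poly_pCons)

text \<open>A real root gives a linear factor. A non-real root \<open>z\<close> gives the factor (x
  - Re z)^2 + (Im z)^2: the remainder modulo it is real, has degree at most one and vanishes at
  \<open>z\<close>, so it is zero.\<close>

lemma real_poly_factor:
  fixes q :: "real poly"
  assumes "degree q \<noteq> 0"
  obtains a p where "q = [:- a, 1:] * p"
  | a b p where "b \<noteq> 0" "q = [:a\<^sup>2 + b\<^sup>2, - 2 * a, 1:] * p"
proof -
  have "\<not> constant (poly (map_poly complex_of_real q))"
    using assms by (simp add: constant_degree degree_map_poly)
  then obtain z where z: "poly (map_poly complex_of_real q) z = 0"
    using fundamental_theorem_of_algebra by blast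
  show thesis
  proof (cases "Im z = 0")
    case True
    then have "z = of_real (Re z)" by (simp add: complex_eq_iff)
    with z have "poly q (Re z) = 0"
      by (metis of_real_eq_0_iff poly_map_of_real_of_real)
    then show thesis using that(1) by (auto simp: poly_eq_0_iff_dvd dvd_def)
  next
    case False
    define Q where "Q = [:(Re z)\<^sup>2 + (Im z)\<^sup>2, - 2 * Re z, 1:]"
    have degQ: "degree Q = 2" by (simp add: Q_def)
    have Qz: "poly (map_poly complex_of_real Q) z = 0"
      by (simp add: Q_def map_poly_pCons complex_eq_iff power2_eq_square algebra_simps)
    have "degree (q mod Q) < 2"
      using degree_mod_less'[of Q q] degQ by (cases "q mod Q = 0") (auto simp: Q_def)
    then have "q mod Q = [:coeff (q mod Q) 0, coeff (q mod Q) 1:]"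
      by (intro poly_eqI) (auto simp: coeff_pCons coeff_eq_0 split: nat.splits)
    then obtain c d where cd: "q mod Q = [:c, d:]" by blast
    have "q = Q * (q div Q) + q mod Q"
      by simp
    then have "poly (map_poly complex_of_real (Q * (q div Q) + q mod Q)) z = 0"
      using z by simp
    then have "poly (map_poly complex_of_real (q mod Q)) z = 0"
      using Qz unfolding poly_map_of_real_add poly_map_of_real_mult by simp
    then have "complex_of_real c + of_real d * z = 0"
      by (simp add: cd map_poly_pCons mult.commute)
    then have "c = 0" "d = 0"
      using False by (auto simp: complex_eq_iff)
    then have "q = Q * (q div Q)"
      using cd by (metis add.right_neutral mult.commute div_mult_mod_eq pCons_0_0)
    then show thesis using that(2)[OF False] by (simp add: Q_def)
  qed
qed

text \<open>
  Positive semidefinite forms are kept on representatives: equality modulo the radical of \<open>B\<close> on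
  \<open>U\<close> is expressed by testing against all vectors of \<open>U\<close>, so that no quotient space is needed.
\<close>

locale psd_form =
  fixes U :: "'a::real_vector set" and B :: "'a \<Rightarrow> 'a \<Rightarrow> real"
  assumes subspace_U: "subspace U"
    and bilinear_B: "bilinear B"
    and B_commute: "B x y = B y x"
    and B_nonneg: "x \<in> U \<Longrightarrow> 0 \<le> B x x"
begin

lemma linear_B: "linear (B x)"
  using bilinear_B by (simp add: bilinear_def)

lemmas B_simps = bilinear_ladd[OF bilinear_B] bilinear_radd[OF bilinear_B]
  bilinear_lmul[OF bilinear_B] bilinear_rmul[OF bilinear_B] bilinear_lsub[OF bilinear_B]
  bilinear_rsub[OF bilinear_B] bilinear_lzero[OF bilinear_B] bilinear_rzero[OF bilinear_B]

lemma B_sum_right: "B x (\<Sum>i\<in>I. c i *\<^sub>R y i) = (\<Sum>i\<in>I. c i * B x (y i))"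
  by (simp add: linear_sum[OF linear_B] B_simps)

lemma B_sum_left: "B (\<Sum>i\<in>I. c i *\<^sub>R y i) x = (\<Sum>i\<in>I. c i * B (y i) x)"
  by (simp add: B_commute[of _ x] B_sum_right)

text \<open>The degenerate case of the Cauchy-Schwarz inequality.\<close>

lemma B_null:
  assumes "x \<in> U" "y \<in> U" "B x x = 0"
  shows "B x y = 0"
proof (rule ccontr)
  assume ne: "B x y \<noteq> 0"
  \<comment> \<open>Chosen so that the form takes the value -1 at
    \<open>t *\<^sub>R x + y\<close>.\<close>
  define t where "t = - (B y y + 1) / (2 * B x y)"
  have "t *\<^sub>R x + y \<in> U"
    using assms subspace_U by (intro subspace_add subspace_scale)
  from B_nonneg[OF this] have "0 \<le> 2 * t * B x y + B y y"
    using assms(3) by (simp add: B_simps B_commute[of y x] algebra_simps)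
  also have "2 * t * B x y = - (B y y + 1)"
    using ne by (simp add: t_def field_simps)
  finally show False by simp
qed

text \<open>Split off a real factor of \<open>q\<close> and apply the cofactor \<open>p\<close> to
  \<open>v\<close>. If the result is null, \<open>p\<close> replaces \<open>q\<close>. If not, a
  linear factor makes it an eigenvector modulo the radical, while an irreducible quadratic factor
  cannot occur because \<open>T\<close> is symmetric.\<close>

lemma poly_apply_self_adjoint_eigenvector:
  assumes "linear T" "\<And>x. x \<in> U \<Longrightarrow> T x \<in> U"
    and adj: "\<And>x y. x \<in> U \<Longrightarrow> y \<in> U \<Longrightarrow> B (T x) y = B x (T y)"
    and W: "subspace W" "W \<subseteq> U" "\<And>x. x \<in> W \<Longrightarrow> T x \<in> W"
    and "v \<in> W" "B v v \<noteq> 0" "q \<noteq> 0" "poly_apply T q v = 0"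
  shows "\<exists>w \<in> W. B w w \<noteq> 0 \<and> (\<exists>a. \<forall>y\<in>U. B (T w) y = a * B w y)"
proof -
  have mem: "poly_apply T p v \<in> W" for p
    using assms by (intro poly_apply_in_subspace) auto
  \<comment> \<open>For the induction \<open>q\<close> need only annihilate \<open>v\<close> modulo
    the radical, a property that the cofactor inherits when its value is null.\<close>
  have "\<lbrakk>q \<noteq> 0; \<forall>y\<in>U. B (poly_apply T q v) y = 0\<rbrakk> \<Longrightarrow> ?thesis"
  proof (induction "degree q" arbitrary: q rule: less_induct)
    case less
    have deg: "degree q \<noteq> 0"
    proof
      assume "degree q = 0"
      then obtain c where q: "q = [:c:]" by (rule degree_eq_zeroE)
      then have "c * B v v = 0"
        using less.prems(2) \<open>v \<in> W\<close> W(2)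
        by (auto simp: poly_apply_pCons assms(1) linear_0 B_simps)
      then show False using less.prems(1) q \<open>B v v \<noteq> 0\<close> by simp
    qed
    from real_poly_factor[OF deg] show ?case
    proof cases
      case (1 a p)
      let ?w = "poly_apply T p v"
      have p0: "p \<noteq> 0" "degree p < degree q"
      proof -
        show "p \<noteq> 0" using less.prems(1) 1 by auto
        then have "degree q = 1 + degree p"
          unfolding 1 by (subst degree_mult_eq) auto
        then show "degree p < degree q" by simp
      qed
      have "poly_apply T q v = T ?w - a *\<^sub>R ?w"
        by (simp add: 1 poly_apply_add poly_apply_diff poly_apply_smult poly_apply_pCons assms(1))
      then have eig: "\<forall>y\<in>U. B (T ?w) y = a * B ?w y"
        using less.prems(2) by (simp add: B_simps)
      show ?thesis
      proof (cases "B ?w ?w = 0")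
        case True
        then have "\<forall>y\<in>U. B ?w y = 0" using B_null mem W(2) by blast
        then show ?thesis using less.hyps p0 by blast
      next
        case False
        then show ?thesis using mem eig by blast
      qed
    next
      case (2 a b p)
      let ?w = "poly_apply T p v" and ?u = "T (poly_apply T p v) - a *\<^sub>R poly_apply T p v"
      have p0: "p \<noteq> 0" "degree p < degree q"
      proof -
        show "p \<noteq> 0" using less.prems(1) 2 by auto
        then have "degree q = 2 + degree p"
          unfolding 2(2) by (subst degree_mult_eq) auto
        then show "degree p < degree q" by simp
      qed
      have wU: "?w \<in> U" "?u \<in> U"
        using mem W assms(2) subspace_U by (auto intro!: subspace_diff subspace_scale)
      have Tu: "T ?u = T (T ?w) - a *\<^sub>R T ?w"
        by (simp add: linear_diff linear_scale assms(1))
      have "poly_apply T q v = (T ?u - a *\<^sub>R ?u) + b\<^sup>2 *\<^sub>R ?w"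
        unfolding 2(2) Tu
        by (simp add: poly_apply_add poly_apply_diff poly_apply_smult poly_apply_pCons assms(1)
            linear_add linear_scale linear_diff algebra_simps power2_eq_square flip: scaleR_add_left)
      \<comment> \<open>Pairing with \<open>?w\<close> and moving \<open>T - a\<close> across turns
        the left side into a sum of two nonnegative terms, so \<open>?w\<close> is null.\<close>
      then have "B (T ?u - a *\<^sub>R ?u) ?w + b\<^sup>2 * B ?w ?w = 0"
        using less.prems(2) wU(1) by (simp add: B_simps)
      also have "B (T ?u - a *\<^sub>R ?u) ?w = B ?u ?u"
        using adj[OF wU(2,1)] by (simp add: B_simps)
      finally have "B ?w ?w = 0"
        using B_nonneg[OF wU(1)] B_nonneg[OF wU(2)] 2(1)
        by (smt (verit) mult_pos_pos zero_less_power2)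
      then have "\<forall>y\<in>U. B ?w y = 0" using B_null wU by blast
      then show ?thesis using less.hyps p0 by blast
    qed
  qed
  with assms show ?thesis by (simp add: B_simps)
qed

text \<open>Induction over the operators: together \<open>adj\<close> and \<open>comm\<close> say
  that they commute modulo the radical, so the joint eigenspace \<open>W'\<close> of the earlier
  ones is invariant under the next. The latter has an annihilating polynomial because its iterates
  stay in \<open>span F\<close>.\<close>

lemma common_eigenvector:
  fixes T :: "'i \<Rightarrow> 'a \<Rightarrow> 'a"
  assumes fin: "finite F" "U \<subseteq> span F"
    and T: "\<And>i. linear (T i)" "\<And>i x. x \<in> U \<Longrightarrow> T i x \<in> U"
    and adj: "\<And>i x y. x \<in> U \<Longrightarrow> y \<in> U \<Longrightarrow> B (T i x) y = B x (T i y)"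
    and comm: "\<And>i j x y. x \<in> U \<Longrightarrow> y \<in> U \<Longrightarrow> B (T i x) (T j y) = B (T j x) (T i y)"
    and W: "subspace W" "W \<subseteq> U" "\<And>i x. x \<in> W \<Longrightarrow> T i x \<in> W"
    and v: "v \<in> W" "B v v \<noteq> 0"
    and "finite J"
  shows "\<exists>w \<in> W. B w w \<noteq> 0 \<and> (\<exists>a. \<forall>j\<in>J. \<forall>y\<in>U. B (T j w) y = a j * B w y)"
  using \<open>finite J\<close>
proof induction
  case empty
  then show ?case using v by auto
next
  case (insert i J)
  then obtain u a where u: "u \<in> W" "B u u \<noteq> 0"
    "\<And>j y. j \<in> J \<Longrightarrow> y \<in> U \<Longrightarrow> B (T j u) y = a j * B u y"
    by blast
  define W' where "W' = {w \<in> W. \<forall>j\<in>J. \<forall>y\<in>U. B (T j w) y = a j * B w y}"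
  have W': "subspace W'" "W' \<subseteq> U" "u \<in> W'"
    using W(1,2) u
    by (auto simp: W'_def subspace_def linear_0 linear_add linear_scale T B_simps algebra_simps)
  have TW': "T i w \<in> W'" if w: "w \<in> W'" for w
  proof -
    have "B (T j (T i w)) y = a j * B (T i w) y" if "j \<in> J" "y \<in> U" for j y
    proof -
      have wU: "w \<in> U" using w W'(2) by blast
      have "B (T j (T i w)) y = B (T j w) (T i y)"
        using adj[of "T i w" y j] comm[of w y i j] T wU that by simp
      also have "\<dots> = a j * B (T i w) y"
        using w that adj[of w y i] T wU by (simp add: W'_def)
      finally show ?thesis .
    qed
    then show ?thesis using w W(3) by (simp add: W'_def)
  qed
  have "(T i ^^ k) u \<in> span F" for k
  proof -
    have "(T i ^^ k) u \<in> W'" using W'(3) TW' by (induction k) auto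
    then show ?thesis using W'(2) fin(2) by blast
  qed
  then obtain q where q: "q \<noteq> 0" "poly_apply (T i) q u = 0"
    using annihilating_poly[OF T(1) fin(1)] by metis
  have "\<exists>w \<in> W'. B w w \<noteq> 0 \<and> (\<exists>c. \<forall>y\<in>U. B (T i w) y = c * B w y)"
    using poly_apply_self_adjoint_eigenvector[OF T(1,2) adj W'(1,2) TW' W'(3) u(2) q] by blast
  then obtain w c where w: "w \<in> W'" "B w w \<noteq> 0" "\<forall>y\<in>U. B (T i w) y = c * B w y"
    by blast
  then have "\<forall>j\<in>insert i J. \<forall>y\<in>U. B (T j w) y = (a(i := c)) j * B w y"
    using insert.hyps by (auto simp: W'_def)
  moreover have "w \<in> W" using w(1) by (simp add: W'_def)
  ultimately show ?case using w(2) by blast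
qed

definition orthonormal_in :: "'a set \<Rightarrow> bool" where
  "orthonormal_in E \<longleftrightarrow>
     finite E \<and> E \<subseteq> U \<and> (\<forall>e\<in>E. \<forall>e'\<in>E. B e e' = (if e = e' then 1 else 0))"

lemma orthonormal_in_independent:
  assumes "orthonormal_in E"
  shows "independent E"
proof (rule independent_if_scalars_zero)
  fix f e
  assume "(\<Sum>e\<in>E. f e *\<^sub>R e) = 0" and e: "e \<in> E"
  then have "(\<Sum>e'\<in>E. f e' * B e e') = 0"
    by (simp add: B_simps flip: B_sum_right)
  also have "(\<Sum>e'\<in>E. f e' * B e e') = (\<Sum>e'\<in>E. if e' = e then f e else 0)"
    using assms e by (intro sum.cong) (auto simp: orthonormal_in_def)
  also have "\<dots> = f e"
    using assms e by (simp add: orthonormal_in_def)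
  finally show "f e = 0" .
qed (use assms in \<open>simp add: orthonormal_in_def\<close>)

text \<open>A maximal orthonormal set of common eigenvectors has a null orthogonal complement.\<close>

theorem simultaneous_diagonalization:
  fixes T :: "'i::finite \<Rightarrow> 'a \<Rightarrow> 'a"
  assumes fin: "finite F" "U \<subseteq> span F"
    and T: "\<And>i. linear (T i)" "\<And>i x. x \<in> U \<Longrightarrow> T i x \<in> U"
    and adj: "\<And>i x y. x \<in> U \<Longrightarrow> y \<in> U \<Longrightarrow> B (T i x) y = B x (T i y)"
    and comm: "\<And>i j x y. x \<in> U \<Longrightarrow> y \<in> U \<Longrightarrow> B (T i x) (T j y) = B (T j x) (T i y)"
  obtains E a where "orthonormal_in E"
    "\<And>e i y. e \<in> E \<Longrightarrow> y \<in> U \<Longrightarrow> B (T i e) y = a e i * B e y"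
    "\<And>x y. x \<in> U \<Longrightarrow> y \<in> U \<Longrightarrow> B x y = (\<Sum>e\<in>E. B x e * B e y)"
proof -
  define eigen where "eigen e \<longleftrightarrow> (\<exists>a. \<forall>i. \<forall>y\<in>U. B (T i e) y = a i * B e y)" for e
  define P where "P E \<longleftrightarrow> orthonormal_in E \<and> (\<forall>e\<in>E. eigen e)" for E
  have "card E \<le> card F" if "P E" for E
    using independent_span_bound[OF fin(1) orthonormal_in_independent, of E] that fin(2)
    unfolding P_def orthonormal_in_def by blast
  then have "\<forall>E. P E \<longrightarrow> card E < Suc (card F)"
    by (simp add: less_Suc_eq_le)
  moreover have "P {}" by (simp add: P_def orthonormal_in_def)
  \<comment> \<open>Orthonormal sets are independent, hence of size at most \<open>card F\<close>,
    and one of largest size exists.\<close>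
  ultimately obtain E where E: "P E" "\<And>E'. P E' \<Longrightarrow> card E' \<le> card E"
    using ex_has_greatest_nat[of P "{}" card "Suc (card F)"] by (metis less_imp_le)
  then have on: "orthonormal_in E" and eig: "\<And>e. e \<in> E \<Longrightarrow> eigen e"
    by (auto simp: P_def)
  then have fE: "finite E" "E \<subseteq> U" "\<And>e e'. e \<in> E \<Longrightarrow> e' \<in> E \<Longrightarrow> B e e' = (if e = e' then 1 else 0)"
    by (auto simp: orthonormal_in_def)
  from eig have "\<forall>e. \<exists>a. e \<in> E \<longrightarrow> (\<forall>i. \<forall>y\<in>U. B (T i e) y = a i * B e y)"
    by (auto simp: eigen_def)
  then obtain a where a: "\<And>e i y. e \<in> E \<Longrightarrow> y \<in> U \<Longrightarrow> B (T i e) y = a e i * B e y"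
    by metis
  define W where "W = {w \<in> U. \<forall>e\<in>E. B w e = 0}"
  have W: "subspace W" "W \<subseteq> U"
    using subspace_U by (auto simp: W_def subspace_def B_simps)
  have TW: "T i w \<in> W" if "w \<in> W" for i w
  proof -
    have "B (T i w) e = 0" if e: "e \<in> E" for e
    proof -
      have "B (T i w) e = B (T i e) w"
        using adj[of w e i] \<open>w \<in> W\<close> e fE(2) by (auto simp: W_def B_commute[of w])
      also have "\<dots> = 0"
        using a[OF e, of w i] \<open>w \<in> W\<close> e by (simp add: W_def B_commute[of e])
      finally show ?thesis .
    qed
    then show ?thesis using that T(2) by (simp add: W_def)
  qed
  have null: "B w w = 0" if "w \<in> W" for w
  proof (rule ccontr)
    assume "B w w \<noteq> 0"
    then have "\<exists>u\<in>W. B u u \<noteq> 0 \<and> (\<exists>b. \<forall>i\<in>UNIV. \<forall>y\<in>U. B (T i u) y = b i * B u y)"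
      by (intro common_eigenvector[where T = T, OF fin T adj comm W TW that]) simp_all
    then obtain u b where u: "u \<in> W" "B u u \<noteq> 0" "\<forall>i. \<forall>y\<in>U. B (T i u) y = b i * B u y"
      by blast
    \<comment> \<open>After normalization the new eigenvector would enlarge
      \<open>E\<close>.\<close>
    define e where "e = (1 / sqrt (B u u)) *\<^sub>R u"
    have pos: "B u u > 0" using u B_nonneg W(2) by (metis less_eq_real_def subsetD)
    have e: "e \<in> W" "B e e = 1"
      using W(1) u(1) pos by (auto simp: e_def subspace_scale B_simps)
    then have orth: "B e e' = 0" "B e' e = 0" if "e' \<in> E" for e'
      using that by (auto simp: W_def B_commute[of e' e])
    have "eigen e"
      unfolding eigen_def using u(3)
      by (intro exI[of _ b]) (simp add: e_def linear_scale T B_simps)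
    moreover have "e \<notin> E" using orth e by fastforce
    moreover have "orthonormal_in (insert e E)"
      using e orth fE W(2) \<open>e \<notin> E\<close> by (auto simp: orthonormal_in_def)
    ultimately have "P (insert e E)" "card (insert e E) = Suc (card E)"
      using E(1) fE(1) by (auto simp: P_def)
    then show False using E(2) by fastforce
  qed
  show thesis
  proof (rule that[OF on a])
    fix x y assume xy: "x \<in> U" "y \<in> U"
    \<comment> \<open>The residual of the expansion is orthogonal to \<open>E\<close>, hence null,
      which gives Parseval's identity.\<close>
    define w where "w = x - (\<Sum>e\<in>E. B x e *\<^sub>R e)"
    have "w \<in> U"
      unfolding w_def using xy fE(2) subspace_U
      by (intro subspace_diff subspace_sum subspace_scale) auto
    moreover have "B w e = 0" if e: "e \<in> E" for e
    proof -
      have "(\<Sum>e'\<in>E. B x e' * B e' e) = (\<Sum>e'\<in>E. if e' = e then B x e else 0)"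
        using e fE(3) by (intro sum.cong) auto
      then show ?thesis
        using e fE(1) by (simp add: w_def B_simps B_sum_left)
    qed
    ultimately have "w \<in> W" by (simp add: W_def)
    then have "B w y = 0" using null B_null xy W(2) by blast
    then show "B x y = (\<Sum>e\<in>E. B x e * B e y)"
      by (simp add: w_def B_simps B_sum_left)
  qed
qed

text \<open>The representing vector is the sum of the \<open>l e *\<^sub>R e\<close> over an
  orthonormal set. What the set misses of \<open>x\<close> is null, and there \<open>l\<close>
  vanishes by assumption.\<close>

lemma riesz_representation:
  assumes fin: "finite F" "U \<subseteq> span F"
    and l: "linear l" "\<And>x. x \<in> U \<Longrightarrow> B x x = 0 \<Longrightarrow> l x = 0"
  shows "\<exists>w\<in>U. \<forall>x\<in>U. B w x = (l x :: real)"
proof -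
  obtain E :: "'a set" where on: "orthonormal_in E"
    and expand: "\<And>x y. x \<in> U \<Longrightarrow> y \<in> U \<Longrightarrow> B x y = (\<Sum>e\<in>E. B x e * B e y)"
    \<comment> \<open>Only the orthonormal set is wanted; the identity serves as a trivially
      admissible operator.\<close>
    by (rule simultaneous_diagonalization[OF fin, where T = "\<lambda>_::unit. id"])
      (blast | simp add: linear_id)+
  define w where "w = (\<Sum>e\<in>E. l e *\<^sub>R e)"
  have "E \<subseteq> U" using on by (simp add: orthonormal_in_def)
  have "w \<in> U"
    unfolding w_def using \<open>E \<subseteq> U\<close> subspace_U
    by (intro subspace_sum subspace_scale) auto
  moreover have "B w x = l x" if "x \<in> U" for x
  proof -
    define z where "z = x - (\<Sum>e\<in>E. B x e *\<^sub>R e)"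
    have "z \<in> U"
      unfolding z_def using \<open>x \<in> U\<close> \<open>E \<subseteq> U\<close> subspace_U
      by (intro subspace_diff subspace_sum subspace_scale) auto
    have "B z y = B x y - (\<Sum>e\<in>E. B x e * B e y)" for y
      by (simp add: z_def B_simps B_sum_left)
    from this[of z] have "B z z = 0"
      using expand[OF \<open>x \<in> U\<close> \<open>z \<in> U\<close>] by linarith
    then have "l z = 0" using l(2) \<open>z \<in> U\<close> by blast
    then have "l x = (\<Sum>e\<in>E. B x e * l e)"
      by (simp add: z_def linear_diff linear_sum linear_scale l(1))
    then show ?thesis
      by (simp add: w_def B_sum_left mult.commute B_commute[of x])
  qed
  ultimately show ?thesis by blast
qed

end

section \<open>Polynomials as a graded algebra\<close>

abbreviation mon :: "'d mindex \<Rightarrow> 'd::finite rpoly" where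
  "mon \<alpha> \<equiv> Poly_Mapping.single \<alpha> 1"

abbreviation var :: "'d \<Rightarrow> 'd::finite rpoly" where
  "var i \<equiv> mon (Poly_Mapping.single i 1)"

section \<open>Multi-indices and linear maps on polynomials\<close>

lemma mabs_0 [simp]: "mabs 0 = 0"
  by (simp add: mabs_def)

lemma mabs_add: "mabs (\<alpha> + \<beta>) = mabs \<alpha> + mabs \<beta>"
  by (simp add: mabs_def lookup_add sum.distrib)

lemma mabs_single [simp]: "mabs (Poly_Mapping.single i k) = k"
  by (simp add: mabs_def lookup_single when_def)

lemma mabs_Suc_obtain:
  assumes "mabs \<alpha> = Suc k"
  obtains i \<beta> where "\<alpha> = Poly_Mapping.single i 1 + \<beta>" "mabs \<beta> = k"
proof -
  obtain i where i: "Poly_Mapping.lookup \<alpha> i \<noteq> 0"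
    using assms by (force simp: mabs_def)
  let ?\<beta> = "\<alpha> - Poly_Mapping.single i 1"
  have "\<alpha> = Poly_Mapping.single i 1 + ?\<beta>"
    using i by (intro poly_mapping_eqI) (auto simp: lookup_add lookup_minus lookup_single when_def)
  moreover from this have "mabs \<alpha> = 1 + mabs ?\<beta>"
    by (metis mabs_add mabs_single)
  ultimately show ?thesis using that assms by simp
qed

lemma mabs_split:
  assumes "mabs \<alpha> \<le> a + b"
  obtains \<beta> \<gamma> where "\<alpha> = \<beta> + \<gamma>" "mabs \<beta> \<le> a" "mabs \<gamma> \<le> b"
  using assms
proof (induction a arbitrary: \<alpha> thesis)
  case 0
  then show ?case by (metis add_0 le0 mabs_0)
next
  case (Suc a)
  show ?case
  proof (cases "mabs \<alpha>")
    case 0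
    then show ?thesis using Suc.prems(1)[of \<alpha> 0] by simp
  next
    case (Suc k)
    then obtain i \<delta> where \<delta>: "\<alpha> = Poly_Mapping.single i 1 + \<delta>" "mabs \<delta> = k"
      by (rule mabs_Suc_obtain)
    then obtain \<beta> \<gamma> where "\<delta> = \<beta> + \<gamma>" "mabs \<beta> \<le> a" "mabs \<gamma> \<le> b"
      using Suc.IH[of \<delta>] Suc.prems(2) Suc by auto
    then show ?thesis
      using Suc.prems(1)[of "Poly_Mapping.single i 1 + \<beta>" \<gamma>] \<delta> by (simp add: mabs_add add.assoc)
  qed
qed

lemma finite_mindices [simp]: "finite (mindices k :: 'd::finite mindex set)"
proof -
  have "Poly_Mapping.lookup \<alpha> i \<le> k" if "mabs \<alpha> \<le> k" for \<alpha> :: "'d mindex" and i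
    using that member_le_sum[of i UNIV "Poly_Mapping.lookup \<alpha>"] by (simp add: mabs_def)
  then have "mindices k \<subseteq> Poly_Mapping.lookup -` (UNIV \<rightarrow>\<^sub>E {..k} :: ('d \<Rightarrow> nat) set)"
    by (auto simp: mindices_def)
  moreover have "finite (Poly_Mapping.lookup -` (UNIV \<rightarrow>\<^sub>E {..k} :: ('d \<Rightarrow> nat) set))"
    by (intro finite_vimageI finite_PiE) (auto simp: inj_def poly_mapping_eqI)
  ultimately show ?thesis by (rule finite_subset)
qed

lemma lookup_scaleR [simp]:
  fixes p :: "'a \<Rightarrow>\<^sub>0 'b::real_vector"
  shows "Poly_Mapping.lookup (c *\<^sub>R p) \<alpha> = c *\<^sub>R Poly_Mapping.lookup p \<alpha>"
proof -
  have "finite {i. c *\<^sub>R Poly_Mapping.lookup p i \<noteq> 0}"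
    by (rule finite_subset[OF _ finite_lookup[of p]]) auto
  then show ?thesis by (simp add: scaleR_poly_mapping_def)
qed

text \<open>Reduces the compatibility of scaling with products to the ring laws.\<close>

lemma scaleR_eq_const_mult:
  fixes p :: "'d::finite rpoly"
  shows "c *\<^sub>R p = Poly_Mapping.single 0 c * p"
  by (rule poly_mapping_eqI)
     (simp add: map.rep_eq when_def flip: mult_map_scale_conv_mult)

lemma poly_mult_scaleR_left:
  fixes p q :: "'d::finite rpoly"
  shows "(c *\<^sub>R p) * q = c *\<^sub>R (p * q)"
  by (simp add: scaleR_eq_const_mult mult.assoc)

lemma poly_mult_scaleR_right:
  fixes p q :: "'d::finite rpoly"
  shows "p * (c *\<^sub>R q) = c *\<^sub>R (p * q)"
  using poly_mult_scaleR_left[of c q p] by (simp add: mult.commute)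

lemma mon_add: "mon (\<alpha> + \<beta>) = mon \<alpha> * mon \<beta>"
  by (simp add: mult_single)

text \<open>The linear map with prescribed values on monomials. It covers \<open>riesz\<close> as
  well as operators whose values are chosen monomial by monomial.\<close>

definition lin_ext :: "('d mindex \<Rightarrow> 'b::real_vector) \<Rightarrow> 'd::finite rpoly \<Rightarrow> 'b" where
  "lin_ext F p = (\<Sum>\<alpha>\<in>Poly_Mapping.keys p. Poly_Mapping.lookup p \<alpha> *\<^sub>R F \<alpha>)"

lemma lin_ext_superset:
  assumes "finite A" "Poly_Mapping.keys p \<subseteq> A"
  shows "lin_ext F p = (\<Sum>\<alpha>\<in>A. Poly_Mapping.lookup p \<alpha> *\<^sub>R F \<alpha>)"
  unfolding lin_ext_def using assms
  by (intro sum.mono_neutral_left) (auto simp: in_keys_iff)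

lemma linear_lin_ext: "linear (lin_ext F)"
proof (rule linearI)
  fix p q :: "'a rpoly"
  let ?A = "Poly_Mapping.keys p \<union> Poly_Mapping.keys q"
  have "Poly_Mapping.keys (p + q) \<subseteq> ?A" by (rule keys_add)
  then show "lin_ext F (p + q) = lin_ext F p + lin_ext F q"
    by (simp add: lin_ext_superset[of ?A] lookup_add scaleR_add_left sum.distrib)
next
  fix c and p :: "'a rpoly"
  have "Poly_Mapping.keys (c *\<^sub>R p) \<subseteq> Poly_Mapping.keys p"
    by (auto simp: in_keys_iff)
  then show "lin_ext F (c *\<^sub>R p) = c *\<^sub>R lin_ext F p"
    by (simp add: lin_ext_superset[of "Poly_Mapping.keys p"] scaleR_sum_right)
qed

lemma lin_ext_mon [simp]: "lin_ext F (mon \<alpha>) = F \<alpha>"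
  by (simp add: lin_ext_def)

lemma poly_expansion: "p = (\<Sum>\<alpha>\<in>Poly_Mapping.keys p. Poly_Mapping.lookup p \<alpha> *\<^sub>R mon \<alpha>)"
  by (rule poly_mapping_eqI)
     (auto simp: lookup_sum lookup_single when_def if_distrib in_keys_iff cong: if_cong)

text \<open>Only the monomials of \<open>p\<close> are compared, so a degree bound on
  \<open>p\<close> can be used in the last premise.\<close>

lemma linear_eq_on_monomials:
  assumes "linear f" "linear h" "\<And>\<alpha>. \<alpha> \<in> Poly_Mapping.keys p \<Longrightarrow> f (mon \<alpha>) = h (mon \<alpha>)"
  shows "f p = h p"
  by (subst (1 2) poly_expansion) (simp add: assms linear_sum linear_scale)

lemma riesz_eq_lin_ext: "riesz \<phi> = lin_ext \<phi>"
  by (simp add: fun_eq_iff riesz_def lin_ext_def)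

lemma linear_riesz: "linear (riesz \<phi>)"
  by (simp add: riesz_eq_lin_ext linear_lin_ext)

lemma riesz_mon [simp]: "riesz \<phi> (mon \<alpha>) = \<phi> \<alpha>"
  by (simp add: riesz_eq_lin_ext)

lemma riesz_1 [simp]: "riesz \<phi> 1 = \<phi> 0"
  using riesz_mon[of \<phi> 0] by simp

lemma poly_val_eq_riesz: "poly_val p x = riesz (\<lambda>\<alpha>. monom_val \<alpha> x) p"
  by (simp add: poly_val_def riesz_def)

lemma linear_poly_val: "linear (\<lambda>p. poly_val p x)"
  by (simp add: poly_val_eq_riesz linear_riesz)

lemma poly_val_mon [simp]: "poly_val (mon \<alpha>) x = monom_val \<alpha> x"
  by (simp add: poly_val_eq_riesz)

lemma monom_val_0 [simp]: "monom_val 0 x = 1"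
  by (simp add: monom_val_def)

lemma monom_val_single [simp]: "monom_val (Poly_Mapping.single i (Suc 0)) x = x $ i"
proof -
  have "monom_val (Poly_Mapping.single i (Suc 0)) x = (\<Prod>j\<in>UNIV. if j = i then x $ j else 1)"
    unfolding monom_val_def by (intro prod.cong) (auto simp: lookup_single)
  then show ?thesis by simp
qed

lemma monom_val_add: "monom_val (\<alpha> + \<beta>) x = monom_val \<alpha> x * monom_val \<beta> x"
  by (simp add: monom_val_def lookup_add power_add prod.distrib)

lemma poly_val_1 [simp]: "poly_val 1 x = 1"
  using poly_val_mon[of 0 x] by simp

lemma linear_mult_const: "linear f \<Longrightarrow> linear (\<lambda>p. f p * (c::real))"
  using linear_compose[of f "\<lambda>y. y * c"] by (simp add: o_def linear_iff algebra_simps)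

lemma linear_mult_left: "linear (\<lambda>p. p * q)" and linear_mult_right: "linear (\<lambda>p. q * p)"
  for q :: "'d::finite rpoly"
  by (auto intro!: linearI simp: algebra_simps poly_mult_scaleR_left poly_mult_scaleR_right)

lemma poly_val_mult: "poly_val (p * q) x = poly_val p x * poly_val q x"
proof -
  have 1: "poly_val (mon \<alpha> * q) x = monom_val \<alpha> x * poly_val q x" for \<alpha>
  proof (rule linear_eq_on_monomials[where f = "\<lambda>q. poly_val (mon \<alpha> * q) x"])
    show "linear (\<lambda>q. poly_val (mon \<alpha> * q) x)"
      using linear_compose[OF linear_mult_right linear_poly_val] by (simp add: o_def)
    show "linear (\<lambda>q. monom_val \<alpha> x * poly_val q x)"
      by (intro linearI) (simp_all add: linear_add[OF linear_poly_val] linear_scale[OF linear_poly_val] algebra_simps)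
  qed (simp add: monom_val_add flip: mon_add)
  show ?thesis
  proof (rule linear_eq_on_monomials[where f = "\<lambda>p. poly_val (p * q) x"])
    show "linear (\<lambda>p. poly_val (p * q) x)"
      using linear_compose[OF linear_mult_left linear_poly_val] by (simp add: o_def)
    show "linear (\<lambda>p. poly_val p x * poly_val q x)"
      by (intro linearI) (simp_all add: linear_add[OF linear_poly_val] linear_scale[OF linear_poly_val] algebra_simps)
  qed (simp add: 1)
qed

section \<open>Polynomials of bounded degree and the moment form\<close>

definition polys :: "nat \<Rightarrow> 'd::finite rpoly set" where
  "polys k = {p. Poly_Mapping.keys p \<subseteq> mindices k}"

lemma subspace_polys: "subspace (polys k)"
proof (rule subspaceI)
  show "0 \<in> polys k" by (simp add: polys_def)
  show "x + y \<in> polys k" if "x \<in> polys k" "y \<in> polys k" for x y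
    using that keys_add[of x y] by (auto simp: polys_def)
  show "c *\<^sub>R x \<in> polys k" if "x \<in> polys k" for c x
    using that by (auto simp: polys_def in_keys_iff)
qed

lemmas polys_intros =
  subspace_add[OF subspace_polys] subspace_diff[OF subspace_polys]
  subspace_scale[OF subspace_polys] subspace_sum[OF subspace_polys]

lemma polys_mono: "j \<le> k \<Longrightarrow> p \<in> polys j \<Longrightarrow> p \<in> polys k"
  by (auto simp: polys_def mindices_def)

lemma mon_in_polys_iff [simp]: "mon \<alpha> \<in> polys k \<longleftrightarrow> mabs \<alpha> \<le> k"
  by (simp add: polys_def mindices_def)

lemma one_in_polys [simp]: "1 \<in> polys k"
  using mon_in_polys_iff[of 0 k] by simp

lemma polys_mult:
  assumes "p \<in> polys a" "q \<in> polys b"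
  shows "p * q \<in> polys (a + b)"
  using assms keys_mult[of p q] by (fastforce simp: polys_def mindices_def mabs_add)

lemma polys_mult_le:
  assumes "p \<in> polys a" "q \<in> polys b" "a + b \<le> k"
  shows "p * q \<in> polys k"
  using polys_mult[OF assms(1,2)] polys_mono assms(3) by blast

lemma polys_tdeg: "p \<in> polys k \<longleftrightarrow> tdeg p \<le> k"
  by (auto simp: polys_def mindices_def tdeg_def)

lemma span_mon_mindices: "span (mon ` mindices k) = (polys k :: 'd::finite rpoly set)"
proof (rule antisym)
  show "span (mon ` mindices k) \<subseteq> (polys k :: 'd rpoly set)"
    by (rule span_minimal[OF _ subspace_polys]) (auto simp: mindices_def)
  show "polys k \<subseteq> span (mon ` mindices k :: 'd rpoly set)"
  proof
    fix p :: "'d rpoly" assume "p \<in> polys k"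
    then show "p \<in> span (mon ` mindices k)"
      by (subst poly_expansion, intro span_sum span_scale) (auto intro: span_base simp: polys_def)
  qed
qed

lemma tdeg_le_2_half_deg: "tdeg p \<le> 2 * half_deg p"
  unfolding half_deg_def by linarith

lemma half_deg_1 [simp]: "half_deg 1 = 0"
  by (simp add: half_deg_def tdeg_def)

text \<open>The bilinear form whose Gram matrix on monomials is
  \<open>moment_mat \<phi>\<close>.\<close>

definition riesz_form :: "'d::finite mseq \<Rightarrow> 'd rpoly \<Rightarrow> 'd rpoly \<Rightarrow> real" where
  "riesz_form \<phi> p q = riesz \<phi> (p * q)"

lemma bilinear_riesz_form: "bilinear (riesz_form \<phi>)"
  using linear_compose[OF linear_mult_left linear_riesz]
    linear_compose[OF linear_mult_right linear_riesz]
  by (auto simp: bilinear_def riesz_form_def o_def)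

lemma riesz_form_commute: "riesz_form \<phi> p q = riesz_form \<phi> q p"
  by (simp add: riesz_form_def mult.commute)

text \<open>The form depends only on the product of its arguments; this is why multiplication
  operators are symmetric and commute.\<close>

lemma riesz_form_mult: "riesz_form \<phi> (p * q) r = riesz_form \<phi> q (p * r)"
  by (simp add: riesz_form_def mult_ac)

lemma riesz_localizing:
  assumes p: "p \<in> polys k"
  shows "riesz \<phi> (g * (p * p)) = (\<Sum>\<alpha>\<in>mindices k. \<Sum>\<beta>\<in>mindices k.
    Poly_Mapping.lookup p \<alpha> * localizing_mat g \<phi> \<alpha> \<beta> * Poly_Mapping.lookup p \<beta>)"
proof -
  have mon: "riesz \<phi> (mon (\<alpha> + \<beta>) * g) = localizing_mat g \<phi> \<alpha> \<beta>" for \<alpha> \<beta>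
  proof -
    have "riesz \<phi> (mon (\<alpha> + \<beta>) * g) = riesz (\<lambda>\<gamma>. \<phi> (\<alpha> + \<beta> + \<gamma>)) g"
    proof (rule linear_eq_on_monomials[OF _ linear_riesz])
      show "linear (\<lambda>g. riesz \<phi> (mon (\<alpha> + \<beta>) * g))"
        using linear_compose[OF linear_mult_right linear_riesz] by (simp add: o_def)
    qed (simp flip: mon_add)
    then show ?thesis by (simp add: riesz_def localizing_mat_def)
  qed
  have exp: "p = (\<Sum>\<alpha>\<in>mindices k. Poly_Mapping.lookup p \<alpha> *\<^sub>R mon \<alpha>)"
    using lin_ext_superset[of "mindices k" p "\<lambda>\<alpha>. mon \<alpha>"] p poly_expansion[of p]
    by (simp add: lin_ext_def polys_def)
  have "g * (p * p) = (\<Sum>\<alpha>\<in>mindices k. \<Sum>\<beta>\<in>mindices k.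
      (Poly_Mapping.lookup p \<alpha> * Poly_Mapping.lookup p \<beta>) *\<^sub>R (mon (\<alpha> + \<beta>) * g))"
    by (subst (1 2) exp)
       (simp add: sum_product sum_distrib_left poly_mult_scaleR_left poly_mult_scaleR_right
         mult_ac mon_add del: mult_single)
  then have "riesz \<phi> (g * (p * p)) = (\<Sum>\<alpha>\<in>mindices k. \<Sum>\<beta>\<in>mindices k.
      Poly_Mapping.lookup p \<alpha> * Poly_Mapping.lookup p \<beta> * localizing_mat g \<phi> \<alpha> \<beta>)"
    by (simp only: linear_sum[OF linear_riesz] linear_scale[OF linear_riesz] mon real_scaleR_def)
  then show ?thesis by (simp add: mult_ac)
qed

lemma localizing_psd_iff:
  fixes g :: "'d::finite rpoly"
  shows "psd_on (mindices k) (localizing_mat g \<phi>) \<longleftrightarrow> (\<forall>p\<in>polys k. 0 \<le> riesz \<phi> (g * (p * p)))"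
    (is "?L \<longleftrightarrow> ?R")
proof
  assume ?L
  then show ?R by (simp add: riesz_localizing psd_on_def)
next
  assume ?R
  have "0 \<le> (\<Sum>\<alpha>\<in>mindices k. \<Sum>\<beta>\<in>mindices k. v \<alpha> * localizing_mat g \<phi> \<alpha> \<beta> * v \<beta>)"
    for v :: "'d mindex \<Rightarrow> real"
  proof -
    \<comment> \<open>Every vector over the index set is the coefficient vector of a polynomial of
      degree at most \<open>k\<close>.\<close>
    let ?p = "\<Sum>\<alpha>\<in>mindices k. v \<alpha> *\<^sub>R mon \<alpha>"
    have "?p \<in> polys k" by (auto intro!: polys_intros simp: mindices_def)
    moreover have "Poly_Mapping.lookup ?p \<alpha> = v \<alpha>" if "\<alpha> \<in> mindices k" for \<alpha>
      using that by (simp add: lookup_sum lookup_single when_def if_distrib cong: if_cong)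
    ultimately show ?thesis
      using \<open>?R\<close> riesz_localizing[of ?p k \<phi> g] by (force intro: order_trans eq_refl)
  qed
  moreover have "localizing_mat g \<phi> \<alpha> \<beta> = localizing_mat g \<phi> \<beta> \<alpha>" for \<alpha> \<beta>
    by (simp add: localizing_mat_def add.commute[of \<alpha>])
  ultimately show ?L by (simp add: psd_on_def)
qed

section \<open>Atomic representations from commuting multiplication operators\<close>

text \<open>\<open>T i\<close> plays the role of multiplication by the \<open>i\<close>-th variable
  on \<open>polys D\<close>. A common eigenvector \<open>e\<close> contributes an atom
  \<open>X e\<close>, whose coordinates are its eigenvalues, with weight the square of
  \<open>riesz \<phi> e\<close>, the component of the polynomial 1 along \<open>e\<close>.\<close>

lemma atomic_representation:
  fixes \<phi> :: "'d::finite mseq" and T :: "'d \<Rightarrow> 'd rpoly \<Rightarrow> 'd rpoly"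
  assumes psd: "\<And>p. p \<in> polys D \<Longrightarrow> 0 \<le> riesz_form \<phi> p p"
    and D: "D \<le> n" "n \<le> D + 1"
    and T: "\<And>i. linear (T i)" "\<And>i p. p \<in> polys D \<Longrightarrow> T i p \<in> polys D"
    and adj: "\<And>i p q. p \<in> polys D \<Longrightarrow> q \<in> polys D \<Longrightarrow>
      riesz_form \<phi> (T i p) q = riesz_form \<phi> p (T i q)"
    and comm: "\<And>i j p q. p \<in> polys D \<Longrightarrow> q \<in> polys D \<Longrightarrow>
      riesz_form \<phi> (T i p) (T j q) = riesz_form \<phi> (T j p) (T i q)"
    and shift: "\<And>i p q. p \<in> polys (n - 1) \<Longrightarrow> q \<in> polys D \<Longrightarrow>
      riesz_form \<phi> (T i p) q = riesz_form \<phi> (var i * p) q"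
  obtains E :: "'d rpoly set" and X :: "'d rpoly \<Rightarrow> real ^ 'd" where
    "finite E" "E \<subseteq> polys D"
    "\<And>e e'. e \<in> E \<Longrightarrow> e' \<in> E \<Longrightarrow> riesz_form \<phi> e e' = (if e = e' then 1 else 0)"
    "\<And>p e. p \<in> polys D \<Longrightarrow> e \<in> E \<Longrightarrow> riesz_form \<phi> p e = poly_val p (X e) * riesz \<phi> e"
    "\<And>p. p \<in> polys (n + D) \<Longrightarrow> riesz \<phi> p = (\<Sum>e\<in>E. (riesz \<phi> e)\<^sup>2 * poly_val p (X e))"
proof -
  interpret psd_form "polys D" "riesz_form \<phi>"
    by unfold_locales
       (simp_all add: subspace_polys bilinear_riesz_form riesz_form_commute psd)
  have fin: "finite (mon ` mindices D :: 'd rpoly set)" "polys D \<subseteq> span (mon ` mindices D :: 'd rpoly set)"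
    by (simp_all add: span_mon_mindices)
  obtain E a where on: "orthonormal_in E"
    and eig: "\<And>e i q. e \<in> E \<Longrightarrow> q \<in> polys D \<Longrightarrow> riesz_form \<phi> (T i e) q = a e i * riesz_form \<phi> e q"
    and expand: "\<And>p q. p \<in> polys D \<Longrightarrow> q \<in> polys D \<Longrightarrow>
      riesz_form \<phi> p q = (\<Sum>e\<in>E. riesz_form \<phi> p e * riesz_form \<phi> e q)"
    using simultaneous_diagonalization[where T = T, OF fin T adj comm] by blast
  have E: "finite E" "E \<subseteq> polys D"
    "\<And>e e'. e \<in> E \<Longrightarrow> e' \<in> E \<Longrightarrow> riesz_form \<phi> e e' = (if e = e' then 1 else 0)"
    using on by (auto simp: orthonormal_in_def)
  define X :: "'d rpoly \<Rightarrow> real ^ 'd" where "X e = (\<chi> i. a e i)" for e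
  have one: "riesz_form \<phi> 1 e = riesz \<phi> e" for e
    by (simp add: riesz_form_def)
  have pick: "(\<Sum>e'\<in>E. F e' * riesz_form \<phi> e' e) = F e" if "e \<in> E" for F e
  proof -
    have "(\<Sum>e'\<in>E. F e' * riesz_form \<phi> e' e) = (\<Sum>e'\<in>E. if e' = e then F e else 0)"
      using that E(3) by (intro sum.cong) auto
    then show ?thesis using that E(1) by simp
  qed
  \<comment> \<open>The bound is \<open>n\<close>, even if \<open>D = n - 1\<close>: peeling off one
    variable leaves degree at most \<open>n - 1\<close>, which lies within both \<open>D\<close> and
    the range of \<open>shift\<close>.\<close>
  have mon_form: "riesz_form \<phi> (mon \<beta>) q =
      (\<Sum>e\<in>E. monom_val \<beta> (X e) * riesz \<phi> e * riesz_form \<phi> e q)"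
    if "mabs \<beta> \<le> n" "q \<in> polys D" for \<beta> q
    using that
  proof (induction "mabs \<beta>" arbitrary: \<beta> q)
    case 0
    then have "\<beta> = 0"
      by (intro poly_mapping_eqI) (simp add: mabs_def)
    then show ?case using expand[of 1 q] 0 by (simp add: one)
  next
    case (Suc k)
    from Suc.hyps(2)[symmetric] obtain i \<gamma>
      where \<gamma>: "\<beta> = Poly_Mapping.single i 1 + \<gamma>" "mabs \<gamma> = k"
      by (rule mabs_Suc_obtain)
    have deg: "mon \<gamma> \<in> polys (n - 1)" "mon \<gamma> \<in> polys D"
      using Suc.prems Suc.hyps(2) \<gamma> D by auto
    have "riesz_form \<phi> (mon \<beta>) q = riesz_form \<phi> (T i (mon \<gamma>)) q"
      using shift[OF deg(1) Suc.prems(2)] by (simp add: \<gamma> mon_add del: mult_single)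
    also have "\<dots> = (\<Sum>e\<in>E. riesz_form \<phi> (T i (mon \<gamma>)) e * riesz_form \<phi> e q)"
      using expand T(2) deg Suc.prems by blast
    also have "\<dots> = (\<Sum>e\<in>E. monom_val \<beta> (X e) * riesz \<phi> e * riesz_form \<phi> e q)"
    proof (rule sum.cong)
      fix e assume e: "e \<in> E"
      then have eD: "e \<in> polys D" using E by blast
      have "riesz_form \<phi> (T i (mon \<gamma>)) e = a e i * riesz_form \<phi> (mon \<gamma>) e"
        using adj[OF deg(2) eD] eig[OF e deg(2)] by (simp add: riesz_form_commute)
      also have "riesz_form \<phi> (mon \<gamma>) e = monom_val \<gamma> (X e) * riesz \<phi> e"
        using Suc.hyps(1)[of \<gamma> e] \<gamma> eD Suc.hyps(2) Suc.prems pick[OF e] by simp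
      also have "a e i = X e $ i" by (simp add: X_def)
      finally show "riesz_form \<phi> (T i (mon \<gamma>)) e * riesz_form \<phi> e q =
          monom_val \<beta> (X e) * riesz \<phi> e * riesz_form \<phi> e q"
        by (simp add: \<gamma> monom_val_add)
    qed simp
    finally show ?case .
  qed
  have low: "riesz_form \<phi> p e = poly_val p (X e) * riesz \<phi> e"
    if p: "p \<in> polys D" and e: "e \<in> E" for p e
  proof (rule linear_eq_on_monomials[where f = "\<lambda>p. riesz_form \<phi> p e"])
    show "linear (\<lambda>p. riesz_form \<phi> p e)"
      using bilinear_B by (simp add: bilinear_def)
    fix \<alpha> assume "\<alpha> \<in> Poly_Mapping.keys p"
    then have "mabs \<alpha> \<le> n" using p D(1) by (auto simp: polys_def mindices_def)
    then show "riesz_form \<phi> (mon \<alpha>) e = poly_val (mon \<alpha>) (X e) * riesz \<phi> e"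
      using mon_form e E(2) pick[OF e] by auto
  qed (simp add: linear_mult_const linear_poly_val)
  have "riesz \<phi> p = (\<Sum>e\<in>E. (riesz \<phi> e)\<^sup>2 * poly_val p (X e))"
    if p: "p \<in> polys (n + D)" for p
  proof (rule linear_eq_on_monomials[OF linear_riesz])
    show "linear (\<lambda>p. \<Sum>e\<in>E. (riesz \<phi> e)\<^sup>2 * poly_val p (X e))"
      unfolding mult.commute[of "(_::real)\<^sup>2"]
      by (intro linear_compose_sum ballI linear_mult_const linear_poly_val)
    fix \<alpha> assume "\<alpha> \<in> Poly_Mapping.keys p"
    then have "mabs \<alpha> \<le> n + D" using p by (auto simp: polys_def mindices_def)
    \<comment> \<open>The factor of degree at most \<open>n\<close> is handled by
      \<open>mon_form\<close>, the one of degree at most \<open>D\<close> by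
      \<open>low\<close>.\<close>
    then obtain \<beta> \<gamma> where \<beta>: "\<alpha> = \<beta> + \<gamma>" "mabs \<beta> \<le> n" "mabs \<gamma> \<le> D"
      by (rule mabs_split)
    have "riesz \<phi> (mon \<alpha>) = riesz_form \<phi> (mon \<beta>) (mon \<gamma>)"
      by (simp add: riesz_form_def mult_single \<beta>)
    also have "\<dots> = (\<Sum>e\<in>E. monom_val \<beta> (X e) * riesz \<phi> e * riesz_form \<phi> e (mon \<gamma>))"
      using mon_form \<beta> by simp
    also have "\<dots> = (\<Sum>e\<in>E. (riesz \<phi> e)\<^sup>2 * poly_val (mon \<alpha>) (X e))"
      using low[of "mon \<gamma>"] \<beta>
      by (intro sum.cong)
         (simp_all add: riesz_form_commute[of _ _ "mon \<gamma>"] monom_val_add power2_eq_square)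
    finally show "riesz \<phi> (mon \<alpha>) = (\<Sum>e\<in>E. (riesz \<phi> e)\<^sup>2 * poly_val (mon \<alpha>) (X e))" .
  qed
  with E low show thesis using that by blast
qed

text \<open>The space of polynomials is infinite-dimensional, so a finite \<open>F\<close> spanning
  \<open>S\<close> carries the finiteness.\<close>

lemma card_independent_le_dim:
  fixes S :: "'a::real_vector set"
  assumes "independent B" "B \<subseteq> S" "finite F" "S \<subseteq> span F"
  shows "finite B" "card B \<le> dim S"
proof -
  obtain C where C: "C \<subseteq> S" "independent C" "S \<subseteq> span C" "card C = dim S"
    using basis_exists by blast
  have "finite C"
    using independent_span_bound[of F C] C assms(3,4) by blast
  moreover have "B \<subseteq> span C" using assms(2) C(3) by (rule subset_trans)
  ultimately show "finite B" "card B \<le> dim S"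
    using independent_span_bound[OF _ assms(1), of C] C(4) by simp_all
qed

lemma subspace_dim_strict:
  fixes S T :: "'a::real_vector set"
  assumes "subspace S" "S \<subset> T" "finite F" "T \<subseteq> span F"
  shows "dim S < dim T"
proof -
  obtain B where B: "B \<subseteq> S" "independent B" "S \<subseteq> span B" "card B = dim S"
    using basis_exists by blast
  obtain x where x: "x \<in> T" "x \<notin> S" using assms(2) by blast
  have "span B \<subseteq> S" using span_minimal B assms(1) by blast
  then have "independent (insert x B)"
    using x B by (intro independent_insertI) auto
  moreover have "insert x B \<subseteq> T" using x B assms(2) by blast
  ultimately have "finite (insert x B)" "card (insert x B) \<le> dim T"
    using card_independent_le_dim[of "insert x B" T F] assms(3,4) by simp_all
  moreover have "x \<notin> B" using x B by blast
  ultimately show ?thesis using B by simp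
qed

lemma lin_ext_in_polys:
  assumes "p \<in> polys k" "\<And>\<alpha>. \<alpha> \<in> mindices k \<Longrightarrow> F \<alpha> \<in> polys l"
  shows "lin_ext F p \<in> polys l"
  unfolding lin_ext_def using assms
  by (intro subspace_sum[OF subspace_polys] subspace_scale[OF subspace_polys])
     (auto simp: polys_def[of k])

section \<open>The radical of a truncated moment form\<close>

locale moment_psd =
  fixes \<phi> :: "'d::finite mseq" and n :: nat
  assumes psd: "p \<in> polys n \<Longrightarrow> 0 \<le> riesz_form \<phi> p p"
    and normalized: "\<phi> 0 = 1"
begin

sublocale psd_form "polys n" "riesz_form \<phi>"
  by unfold_locales (simp_all add: subspace_polys bilinear_riesz_form riesz_form_commute psd)

definition null :: "'d rpoly \<Rightarrow> bool" where
  "null p \<longleftrightarrow> (\<forall>q\<in>polys n. riesz_form \<phi> p q = 0)"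

text \<open>Pair \<open>var i * p\<close> with itself and move one variable across: the other
  argument has degree at most \<open>n\<close>, so the nullity of \<open>p\<close> applies, and
  \<open>B_null\<close> does the rest.\<close>

lemma null_mult_var:
  assumes "null p" "var i * p \<in> polys (n - 1)" "1 \<le> n"
  shows "null (var i * p)"
proof -
  have "var i * p \<in> polys n" using assms(2) polys_mono by (metis diff_le_self)
  moreover have "var i * (var i * p) \<in> polys n"
    using assms(2,3) polys_mult_le[of "var i" 1 "var i * p" "n - 1" n] by simp
  then have "riesz_form \<phi> (var i * p) (var i * p) = 0"
    using assms(1) by (simp only: riesz_form_mult null_def)
  ultimately show ?thesis using B_null by (simp add: null_def)
qed

text \<open>The product of the moment matrix with the coefficient vector of \<open>p\<close>.\<close>

definition colvec :: "'d rpoly \<Rightarrow> 'd rpoly" where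
  "colvec p = (\<Sum>\<alpha>\<in>mindices n. Poly_Mapping.single \<alpha> (riesz_form \<phi> (mon \<alpha>) p))"

lemma lookup_colvec:
  "Poly_Mapping.lookup (colvec p) \<alpha> = (if \<alpha> \<in> mindices n then riesz_form \<phi> (mon \<alpha>) p else 0)"
  by (simp add: colvec_def lookup_sum lookup_single when_def)

lemma linear_colvec: "linear colvec"
  by (intro linearI poly_mapping_eqI) (auto simp: lookup_colvec lookup_add B_simps)

text \<open>Thus \<open>colvec\<close> realizes the quotient by the radical inside polynomials, and
  ranks become dimensions of images.\<close>

lemma colvec_eq_0_iff: "colvec p = 0 \<longleftrightarrow> null p"
proof
  assume 0: "colvec p = 0"
  have *: "riesz_form \<phi> p (mon \<alpha>) = 0" if "\<alpha> \<in> mindices n" for \<alpha>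
    using that lookup_colvec[of p \<alpha>] unfolding 0 by (simp add: B_commute[of p "mon \<alpha>"])
  show "null p"
    unfolding null_def
  proof
    fix q :: "'d rpoly" assume q: "q \<in> polys n"
    show "riesz_form \<phi> p q = 0"
      by (rule linear_eq_on_monomials[OF linear_B linear_zero]) (use q * in \<open>auto simp: polys_def\<close>)
  qed
next
  assume null: "null p"
  have "riesz_form \<phi> (mon \<alpha>) p = 0" if "\<alpha> \<in> mindices n" for \<alpha>
    using null that unfolding null_def B_commute[of "mon \<alpha>" p] by (simp add: mindices_def)
  then show "colvec p = 0"
    by (intro poly_mapping_eqI) (simp add: lookup_colvec)
qed

lemma null_diff_iff: "null (p - q) \<longleftrightarrow> colvec p = colvec q"
  by (simp add: linear_diff[OF linear_colvec] flip: colvec_eq_0_iff)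

lemma colvec_polys: "colvec ` polys k = span (colvec ` mon ` mindices k)"
  using linear_span_image[OF linear_colvec, of "mon ` mindices k"]
  unfolding span_mon_mindices by (rule sym)

lemma subspace_colvec_polys: "subspace (colvec ` polys k)"
  by (simp add: colvec_polys)

lemma colvec_polys_mono: "j \<le> k \<Longrightarrow> colvec ` polys j \<subseteq> colvec ` polys k"
  using polys_mono by blast

lemma dim_colvec_strict:
  assumes "S \<subset> colvec ` polys k" "subspace S"
  shows "dim S < dim (colvec ` polys k)"
proof (rule subspace_dim_strict[OF assms(2,1)])
  show "finite (colvec ` mon ` mindices k)" by simp
  show "colvec ` polys k \<subseteq> span (colvec ` mon ` mindices k)" by (simp add: colvec_polys)
qed

lemma dim_colvec_mono: "j \<le> k \<Longrightarrow> dim (colvec ` polys j) \<le> dim (colvec ` polys k)"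
  using dim_colvec_strict[OF _ subspace_colvec_polys, of j k] colvec_polys_mono[of j k]
  by (metis less_imp_le order_refl psubsetI)

lemma colvec_polys_eqI:
  assumes "j \<le> k" "dim (colvec ` polys k) \<le> dim (colvec ` polys j)"
  shows "colvec ` polys j = colvec ` polys k"
  using dim_colvec_strict[OF _ subspace_colvec_polys, of j k] colvec_polys_mono[OF assms(1)]
    assms(2) by (metis not_le psubsetI)

lemma colvec_1: "colvec 1 \<noteq> 0"
proof
  assume "colvec 1 = 0"
  then have "riesz_form \<phi> 1 1 = 0" by (simp add: colvec_eq_0_iff null_def)
  then show False using normalized by (simp add: riesz_form_def)
qed

lemma dim_colvec_pos: "1 \<le> dim (colvec ` polys k)"
proof -
  have "{0} \<subset> colvec ` polys k"
    using colvec_1 subspace_0[OF subspace_colvec_polys] by fastforce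
  then show ?thesis using dim_colvec_strict[of "{0}" k] by simp
qed

text \<open>Bounds the number of atoms by the rank: pairing a combination of \<open>E\<close> with
  its members recovers the coefficients, so \<open>colvec\<close> is injective on
  \<open>span E\<close>.\<close>

lemma card_orthonormal_le_dim:
  assumes "finite E" "E \<subseteq> polys n"
    and "\<And>e e'. e \<in> E \<Longrightarrow> e' \<in> E \<Longrightarrow> riesz_form \<phi> e e' = (if e = e' then 1 else 0)"
  shows "card E \<le> dim (colvec ` polys n)"
proof -
  have on: "orthonormal_in E" using assms by (auto simp: orthonormal_in_def)
  have inj: "inj_on colvec (span E)"
  proof (rule inj_onI)
    fix x y assume xy: "x \<in> span E" "y \<in> span E" "colvec x = colvec y"
    then have "x - y \<in> span E" by (simp add: span_diff)
    then obtain u where u: "x - y = (\<Sum>e\<in>E. u e *\<^sub>R e)"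
      using assms(1) by (auto simp: span_finite)
    have "u e = 0" if e: "e \<in> E" for e
    proof -
      have "0 = riesz_form \<phi> (x - y) e"
        using xy(3)[folded null_diff_iff] e assms(2) by (auto simp: null_def)
      also have "\<dots> = (\<Sum>e'\<in>E. u e' * riesz_form \<phi> e' e)"
        by (simp only: u B_sum_left)
      also have "\<dots> = (\<Sum>e'\<in>E. if e' = e then u e else 0)"
        using e assms(3) by (intro sum.cong) auto
      finally show ?thesis using e assms(1) by simp
    qed
    then show "x = y" using u by simp
  qed
  have card: "card (colvec ` E) = card E"
    by (rule card_image[OF inj_on_subset[OF inj span_superset]])
  have ind: "independent (colvec ` E)"
    by (rule linear_independent_injective_image
        [OF linear_colvec orthonormal_in_independent[OF on] inj])
  have "card (colvec ` E) \<le> dim (colvec ` polys n)"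
  proof (rule card_independent_le_dim(2)[OF ind])
    show "colvec ` E \<subseteq> colvec ` polys n" using assms(2) by blast
    show "finite (colvec ` mon ` mindices n)" by simp
    show "colvec ` polys n \<subseteq> span (colvec ` mon ` mindices n)" by (simp add: colvec_polys)
  qed
  then show ?thesis by (simp add: card)
qed

text \<open>Representatives of degree at most \<open>t\<close> are chosen on monomials and extended
  linearly.\<close>

lemma linear_reduction:
  assumes "colvec ` polys t = colvec ` polys k"
  obtains \<pi> where "linear \<pi>" "\<And>p. p \<in> polys k \<Longrightarrow> \<pi> p \<in> polys t"
    "\<And>p. p \<in> polys k \<Longrightarrow> null (p - \<pi> p)"
proof -
  have "\<exists>r\<in>polys t. null (mon \<alpha> - r)" if "\<alpha> \<in> mindices k" for \<alpha>
  proof -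
    have "colvec (mon \<alpha>) \<in> colvec ` polys t"
      using that assms by (auto simp: mindices_def)
    then show ?thesis by (auto simp: null_diff_iff)
  qed
  then obtain r where r: "\<And>\<alpha>. \<alpha> \<in> mindices k \<Longrightarrow> r \<alpha> \<in> polys t \<and> null (mon \<alpha> - r \<alpha>)"
    by metis
  have "lin_ext r p \<in> polys t" "null (p - lin_ext r p)" if "p \<in> polys k" for p
  proof -
    show "lin_ext r p \<in> polys t"
      using that r by (intro lin_ext_in_polys) auto
    have "colvec p = colvec (lin_ext r p)"
    proof (rule linear_eq_on_monomials[OF linear_colvec])
      show "linear (\<lambda>p. colvec (lin_ext r p))"
        using linear_compose[OF linear_lin_ext linear_colvec] by (simp add: o_def)
    qed (use that r in \<open>auto simp: polys_def null_diff_iff\<close>)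
    then show "null (p - lin_ext r p)" by (simp add: null_diff_iff)
  qed
  then show thesis using that[OF linear_lin_ext] by blast
qed

text \<open>Symmetry and commutation are required only through the form. Agreement with true
  multiplication is asked up to degree \<open>n - 1\<close>, where the product has degree at most
  \<open>n\<close>.\<close>

definition multiplication_operators :: "nat \<Rightarrow> ('d \<Rightarrow> 'd rpoly \<Rightarrow> 'd rpoly) \<Rightarrow> bool" where
  "multiplication_operators D T \<longleftrightarrow>
     (\<forall>i. linear (T i)) \<and> (\<forall>i. \<forall>p\<in>polys D. T i p \<in> polys D) \<and>
     (\<forall>i. \<forall>p\<in>polys D. \<forall>q\<in>polys D. riesz_form \<phi> (T i p) q = riesz_form \<phi> p (T i q)) \<and>
     (\<forall>i j. \<forall>p\<in>polys D. \<forall>q\<in>polys D. riesz_form \<phi> (T i p) (T j q) = riesz_form \<phi> (T j p) (T i q)) \<and>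
     (\<forall>i. \<forall>p\<in>polys (n - 1). \<forall>q\<in>polys D. riesz_form \<phi> (T i p) q = riesz_form \<phi> (var i * p) q)"

text \<open>Reducing to degree \<open>t < D\<close> before multiplying by a variable keeps the
  product in \<open>polys D\<close>, and the reduction is invisible to the form.\<close>

lemma flat_multiplication_operators:
  assumes flat: "colvec ` polys t = colvec ` polys D" and D: "t + 1 \<le> D" "D \<le> n" "n \<le> D + 1"
  shows "\<exists>T. multiplication_operators D T"
proof -
  obtain \<pi> where \<pi>: "linear \<pi>" "\<And>p. p \<in> polys D \<Longrightarrow> \<pi> p \<in> polys t"
    "\<And>p. p \<in> polys D \<Longrightarrow> null (p - \<pi> p)"
    using linear_reduction[OF flat] by blast
  define T where "T i p = var i * \<pi> p" for i p
  have deg: "var i * \<pi> p \<in> polys D" if "p \<in> polys D" for i p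
    using \<pi>(2)[OF that] D(1) by (intro polys_mult_le[of _ 1 _ t]) auto
  have reduce: "riesz_form \<phi> p q = riesz_form \<phi> p (\<pi> q)" if "p \<in> polys D" "q \<in> polys D" for p q
  proof -
    have "riesz_form \<phi> (q - \<pi> q) p = 0"
      using \<pi>(3)[OF that(2)] polys_mono[OF D(2) that(1)] by (simp add: null_def)
    then show ?thesis by (simp add: B_simps B_commute[of p])
  qed
  have "linear (T i)" for i
    using linear_compose[OF \<pi>(1) linear_mult_right] by (simp add: T_def[abs_def] o_def)
  moreover have "riesz_form \<phi> (T i p) q = riesz_form \<phi> p (T i q)"
    if pq: "p \<in> polys D" "q \<in> polys D" for i p q
  proof -
    have "riesz_form \<phi> (T i p) q = riesz_form \<phi> (T i p) (\<pi> q)"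
      using reduce pq deg by (simp add: T_def)
    also have "\<dots> = riesz_form \<phi> (T i q) (\<pi> p)"
      by (simp add: T_def riesz_form_def mult_ac)
    also have "\<dots> = riesz_form \<phi> (T i q) p"
      using reduce[of "T i q" p] pq deg by (simp add: T_def)
    finally show ?thesis by (simp add: B_commute)
  qed
  moreover have "riesz_form \<phi> (T i p) (T j q) = riesz_form \<phi> (T j p) (T i q)" for i j p q
    by (simp add: T_def riesz_form_def mult_ac)
  moreover have "riesz_form \<phi> (T i p) q = riesz_form \<phi> (var i * p) q"
    if p: "p \<in> polys (n - 1)" and q: "q \<in> polys D" for i p q
  proof -
    have pD: "p \<in> polys D" using p D(3) polys_mono by (metis le_diff_conv)
    let ?\<nu> = "p - \<pi> p"
    \<comment> \<open>If \<open>D = n - 1\<close>, the variable can be moved to \<open>q\<close>. If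
      \<open>D = n\<close>, this could exceed degree \<open>n\<close>, so \<open>q\<close> is first
      replaced by its reduction.\<close>
    have "riesz_form \<phi> (var i * ?\<nu>) q = 0"
    proof (cases "D = n")
      case False
      then have "var i * q \<in> polys n"
        using q D by (intro polys_mult_le[of _ 1 _ D]) auto
      then show ?thesis using \<pi>(3)[OF pD] by (simp only: riesz_form_mult null_def)
    next
      case True
      have "t \<le> n - 1" using D by arith
      then have "?\<nu> \<in> polys (n - 1)"
        using p \<pi>(2)[OF pD] polys_mono by (intro polys_intros) blast+
      then have "var i * ?\<nu> \<in> polys D"
        using D True polys_mult_le[of "var i" 1 ?\<nu> "n - 1" D] by simp
      from reduce[OF this q]
      have "riesz_form \<phi> (var i * ?\<nu>) q = riesz_form \<phi> ?\<nu> (var i * \<pi> q)"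
        by (simp only: riesz_form_mult)
      then show ?thesis using \<pi>(3)[OF pD] deg[OF q] True by (simp add: null_def)
    qed
    then show ?thesis by (simp add: T_def B_simps right_diff_distrib)
  qed
  ultimately have "multiplication_operators D T"
    using deg by (auto simp: multiplication_operators_def T_def)
  then show ?thesis by blast
qed

text \<open>Iterates \<open>null_mult_var\<close>: every intermediate product has degree at most
  \<open>mabs \<alpha> + 1\<close>, hence at most \<open>n - 1\<close>.\<close>

lemma null_mult_mon:
  assumes "null p" "p \<in> polys 1" "mabs \<alpha> + 2 \<le> n"
  shows "null (mon \<alpha> * p)"
  using assms(3)
proof (induction "mabs \<alpha>" arbitrary: \<alpha>)
  case 0
  then have "\<alpha> = 0" by (intro poly_mapping_eqI) (simp add: mabs_def)
  then show ?case using assms(1) by simp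
next
  case (Suc k)
  from Suc.hyps(2)[symmetric] obtain i \<gamma>
    where \<gamma>: "\<alpha> = Poly_Mapping.single i 1 + \<gamma>" "mabs \<gamma> = k"
    by (rule mabs_Suc_obtain)
  have eq: "mon \<alpha> * p = var i * (mon \<gamma> * p)"
    by (simp add: \<gamma> mon_add mult.assoc del: mult_single)
  have "mon \<alpha> * p \<in> polys (n - 1)"
    using assms(2) Suc.prems by (intro polys_mult_le[of _ "mabs \<alpha>" _ 1]) auto
  then show ?case
    unfolding eq using Suc \<gamma> by (intro null_mult_var) auto
qed

text \<open>\<open>null_mult_mon\<close> only reaches monomials of degree \<open>n - 2\<close>; for
  degree \<open>n - 1\<close> the remaining variable is moved to \<open>q\<close>.\<close>

lemma linear_form_times_null:
  assumes \<nu>: "null \<nu>" "\<nu> \<in> polys 1" and n: "2 \<le> n"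
    and p: "p \<in> polys (n - 1)" and q: "q \<in> polys (n - 1)"
  shows "riesz_form \<phi> (\<nu> * p) q = 0"
proof -
  have *: "riesz_form \<phi> (\<nu> * mon \<alpha>) q = 0" if \<alpha>: "mabs \<alpha> \<le> n - 1" for \<alpha>
  proof (cases "mabs \<alpha>")
    case 0
    then have "\<alpha> = 0" by (intro poly_mapping_eqI) (simp add: mabs_def)
    moreover have "q \<in> polys n" using q polys_mono by (metis diff_le_self)
    ultimately show ?thesis using \<nu>(1) by (simp add: null_def)
  next
    case (Suc k)
    then obtain i \<gamma> where \<gamma>: "\<alpha> = Poly_Mapping.single i 1 + \<gamma>" "mabs \<gamma> = k"
      by (rule mabs_Suc_obtain)
    have "null (mon \<gamma> * \<nu>)"
      using \<alpha> Suc \<gamma> n by (intro null_mult_mon \<nu>) arith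
    moreover have "var i * q \<in> polys n"
      using q n polys_mult_le[of "var i" 1 q "n - 1" n] by simp
    ultimately have "riesz_form \<phi> (mon \<gamma> * \<nu>) (var i * q) = 0"
      by (simp add: null_def)
    moreover have "riesz_form \<phi> (\<nu> * mon \<alpha>) q = riesz_form \<phi> (mon \<gamma> * \<nu>) (var i * q)"
      unfolding \<gamma> mon_add by (simp only: riesz_form_def mult_ac)
    ultimately show ?thesis by simp
  qed
  have "linear (\<lambda>p. riesz_form \<phi> (\<nu> * p) q)"
    using linear_compose[OF linear_mult_right, of "\<lambda>p. riesz_form \<phi> p q" \<nu>] bilinear_B
    by (simp add: bilinear_def o_def)
  then show ?thesis
    by (rule linear_eq_on_monomials[OF _ linear_zero])
       (use p * in \<open>auto simp: polys_def mindices_def\<close>)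
qed

text \<open>As \<open>colvec 1\<close> is nonzero, a space of dimension at most two leaves room for
  only one further direction.\<close>

lemma line_generator:
  assumes "dim (colvec ` polys 1) \<le> 2"
  obtains h where "h \<in> polys 1" "\<And>p. p \<in> polys 1 \<Longrightarrow> \<exists>a b. null (p - (a *\<^sub>R 1 + b *\<^sub>R h))"
proof -
  have "\<exists>h\<in>polys 1. colvec ` polys 1 \<subseteq> span {colvec 1, colvec h}"
  proof (cases "colvec ` polys 1 \<subseteq> span {colvec 1}")
    case True
    then show ?thesis by (intro bexI[of _ 1]) auto
  next
    case False
    then obtain h where h: "h \<in> polys 1" "colvec h \<notin> span {colvec 1}" by blast
    have ind: "independent {colvec h, colvec 1}"
      using h(2) colvec_1 by (intro independent_insertI independent_empty) auto
    have "colvec h \<noteq> colvec 1" using h(2) by (auto intro: span_base)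
    then have dim: "dim (span {colvec 1, colvec h}) = 2"
      using dim_span_eq_card_independent[OF ind] by (simp add: insert_commute)
    have "span {colvec 1, colvec h} \<subseteq> colvec ` polys 1"
      using h(1) by (intro span_minimal subspace_colvec_polys) auto
    moreover have "\<not> span {colvec 1, colvec h} \<subset> colvec ` polys 1"
      using dim_colvec_strict[of "span {colvec 1, colvec h}" 1] dim assms by auto
    ultimately show ?thesis using h(1) by blast
  qed
  then obtain h where h: "h \<in> polys 1" "colvec ` polys 1 \<subseteq> span {colvec 1, colvec h}"
    by blast
  have "\<exists>a b. null (p - (a *\<^sub>R 1 + b *\<^sub>R h))" if "p \<in> polys 1" for p
  proof -
    have "colvec p \<in> span {colvec 1, colvec h}" using h that by blast
    then obtain a where "colvec p - a *\<^sub>R colvec 1 \<in> span {colvec h}"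
      using span_breakdown_eq by blast
    then obtain b where "colvec p - a *\<^sub>R colvec 1 = b *\<^sub>R colvec h"
      by (auto simp: span_singleton)
    then have "colvec p = colvec (a *\<^sub>R 1 + b *\<^sub>R h)"
      by (simp add: linear_add[OF linear_colvec] linear_scale[OF linear_colvec] algebra_simps)
    then show ?thesis using null_diff_iff by blast
  qed
  with h that show thesis by blast
qed

text \<open>
  If the linear forms are spanned modulo the radical by \<open>1\<close> and \<open>h\<close>, then \<open>\<phi>\<close> lives on a line up
  to degree \<open>2 * n - 2\<close>, and all coordinates act through the single compression of \<open>h\<close>.
\<close>

lemma line_multiplication_operators:
  assumes dim: "dim (colvec ` polys 1) \<le> 2" and n: "2 \<le> n"
  shows "\<exists>T. multiplication_operators (n - 1) T"
proof -
  let ?U = "polys (n - 1) :: 'd rpoly set"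
  obtain h where h: "h \<in> polys 1" "\<And>p. p \<in> polys 1 \<Longrightarrow> \<exists>a b. null (p - (a *\<^sub>R 1 + b *\<^sub>R h))"
    using line_generator[OF dim] by blast
  have "\<exists>a b. null (var i - (a *\<^sub>R 1 + b *\<^sub>R h))" for i
    using h(2)[of "var i"] by simp
  then obtain a b where ab: "\<And>i. null (var i - (a i *\<^sub>R 1 + b i *\<^sub>R h))" by metis
  have Un: "p \<in> polys n" if "p \<in> ?U" for p using that polys_mono by (metis diff_le_self)
  have hU: "h * p \<in> polys n" if "p \<in> ?U" for p
    using polys_mult_le[OF h(1) that, of n] n by simp
  interpret low: psd_form ?U "riesz_form \<phi>"
    using Un by unfold_locales (simp_all add: subspace_polys bilinear_B B_commute psd)
  \<comment> \<open>\<open>h * p\<close> may have degree \<open>n\<close> and so leave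
    \<open>?U\<close>; its compression to \<open>?U\<close> is obtained by representing the
    functional that it induces.\<close>
  have repr: "\<exists>w\<in>?U. \<forall>q\<in>?U. riesz_form \<phi> w q = riesz_form \<phi> (h * p) q" if p: "p \<in> ?U" for p
  proof (rule low.riesz_representation)
    show "finite (mon ` mindices (n - 1))" by simp
    show "?U \<subseteq> span (mon ` mindices (n - 1))" by (simp add: span_mon_mindices)
    show "linear (riesz_form \<phi> (h * p))" by (rule linear_B)
    show "riesz_form \<phi> (h * p) q = 0" if "q \<in> ?U" "riesz_form \<phi> q q = 0" for q
      using B_null[OF Un[OF that(1)] hU[OF p] that(2)] by (simp add: B_commute)
  qed
  have "\<exists>w. w \<in> ?U \<and> (\<forall>q\<in>?U. riesz_form \<phi> w q = riesz_form \<phi> (h * mon \<alpha>) q)"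
    if "\<alpha> \<in> mindices (n - 1)" for \<alpha>
    using repr[of "mon \<alpha>"] that by (auto simp: mindices_def)
  then obtain w where w: "\<And>\<alpha>. \<alpha> \<in> mindices (n - 1) \<Longrightarrow>
      w \<alpha> \<in> ?U \<and> (\<forall>q\<in>?U. riesz_form \<phi> (w \<alpha>) q = riesz_form \<phi> (h * mon \<alpha>) q)"
    by metis
  define H where "H = lin_ext w"
  have linH: "linear H" by (simp add: H_def linear_lin_ext)
  have HU: "H p \<in> ?U" if "p \<in> ?U" for p
    unfolding H_def using that w by (intro lin_ext_in_polys) auto
  have H: "riesz_form \<phi> (H p) q = riesz_form \<phi> (h * p) q" if p: "p \<in> ?U" and q: "q \<in> ?U" for p q
  proof (rule linear_eq_on_monomials[where f = "\<lambda>p. riesz_form \<phi> (H p) q"])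
    have lin: "linear (\<lambda>p. riesz_form \<phi> p q)"
      using bilinear_B by (simp add: bilinear_def)
    show "linear (\<lambda>p. riesz_form \<phi> (H p) q)"
      using linear_compose[OF linH lin] by (simp add: o_def)
    show "linear (\<lambda>p. riesz_form \<phi> (h * p) q)"
      using linear_compose[OF linear_mult_right lin] by (simp add: o_def)
  qed (use p q w in \<open>auto simp: H_def polys_def\<close>)
  have H_adj: "riesz_form \<phi> (H p) q = riesz_form \<phi> p (H q)" if "p \<in> ?U" "q \<in> ?U" for p q
    using H[OF that] H[OF that(2,1)] by (simp add: B_commute[of p] riesz_form_mult)
  \<comment> \<open>Affine functions of one symmetric operator commute, so commutation is
    automatic.\<close>
  define T where "T i p = a i *\<^sub>R p + b i *\<^sub>R H p" for i p
  have "linear (T i)" for i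
    unfolding T_def
    by (intro linearI) (simp_all add: linear_add[OF linH] linear_scale[OF linH] algebra_simps)
  moreover have "T i p \<in> ?U" if "p \<in> ?U" for i p
    using that HU by (auto simp: T_def intro!: polys_intros)
  moreover have "riesz_form \<phi> (T i p) q = riesz_form \<phi> p (T i q)" if "p \<in> ?U" "q \<in> ?U" for i p q
    using H_adj[OF that] by (simp add: T_def B_simps)
  moreover have "riesz_form \<phi> (T i p) (T j q) = riesz_form \<phi> (T j p) (T i q)"
    if "p \<in> ?U" "q \<in> ?U" for i j p q
    using H_adj[OF that] by (simp add: T_def B_simps algebra_simps)
  moreover have "riesz_form \<phi> (T i p) q = riesz_form \<phi> (var i * p) q"
    if p: "p \<in> ?U" and q: "q \<in> ?U" for i p q
  proof -
    have "var i - (a i *\<^sub>R 1 + b i *\<^sub>R h) \<in> polys 1"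
      using h(1) by (intro polys_intros) auto
    from linear_form_times_null[OF ab this n p q]
    have "riesz_form \<phi> (var i * p) q = a i * riesz_form \<phi> p q + b i * riesz_form \<phi> (h * p) q"
      by (simp add: left_diff_distrib distrib_right poly_mult_scaleR_left B_simps)
    then show ?thesis using H[OF p q] by (simp add: T_def B_simps)
  qed
  ultimately have "multiplication_operators (n - 1) T"
    by (simp add: multiplication_operators_def)
  then show ?thesis by blast
qed

text \<open>Multiplying a null difference by a variable keeps it null, so a stalled rank stays
  stalled. The degree restriction in \<open>null_mult_var\<close> stops this at
  \<open>n - 1\<close>.\<close>

lemma colvec_flat_step:
  assumes flat: "colvec ` polys t = colvec ` polys (t + 1)" and "t \<le> k" "k + 1 \<le> n"
  shows "colvec ` polys t = colvec ` polys k"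
  using assms(2,3)
proof (induction k rule: dec_induct)
  case (step k)
  have "colvec (mon \<alpha>) \<in> colvec ` polys t" if \<alpha>: "mabs \<alpha> \<le> Suc k" for \<alpha>
  proof (cases "mabs \<alpha>")
    case 0
    then show ?thesis by simp
  next
    case (Suc l)
    then obtain i \<gamma> where \<gamma>: "\<alpha> = Poly_Mapping.single i 1 + \<gamma>" "mabs \<gamma> = l"
      by (rule mabs_Suc_obtain)
    have "mon \<gamma> \<in> polys k" using \<alpha> Suc \<gamma> by simp
    moreover have "colvec ` polys t = colvec ` polys k" using step by simp
    ultimately have "colvec (mon \<gamma>) \<in> colvec ` polys t" by blast
    then obtain p where p: "p \<in> polys t" "null (mon \<gamma> - p)"
      by (auto simp: null_diff_iff)
    have "mon \<gamma> - p \<in> polys k"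
      using \<open>mon \<gamma> \<in> polys k\<close> p(1) polys_mono[OF step(1)] by (intro polys_intros) auto
    then have "var i * (mon \<gamma> - p) \<in> polys (n - 1)"
      using step.prems polys_mult_le[of "var i" 1 "mon \<gamma> - p" k "n - 1"] by simp
    then have "null (var i * (mon \<gamma> - p))"
      using p(2) step.prems by (intro null_mult_var) auto
    then have "colvec (mon \<alpha>) = colvec (var i * p)"
      by (simp add: \<gamma> mon_add right_diff_distrib null_diff_iff del: mult_single)
    moreover have "var i * p \<in> polys (t + 1)"
      using p(1) polys_mult_le[of "var i" 1 p t "t + 1"] by simp
    ultimately show ?thesis using flat by auto
  qed
  then have "colvec ` polys (Suc k) \<subseteq> colvec ` polys t"
    unfolding colvec_polys[of "Suc k"]
    by (intro span_minimal subspace_colvec_polys) (auto simp: mindices_def)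
  moreover have "colvec ` polys t \<subseteq> colvec ` polys (Suc k)"
    using step(1) by (intro colvec_polys_mono) simp
  ultimately show ?case by blast
qed simp

text \<open>
  Either the ranks of the leading blocks stabilise early enough, or they increase strictly. By
  the rank bound, the latter leaves either flatness at the top or, for \<open>v = 0\<close>, a sequence on a line.
\<close>

lemma low_rank_multiplication_operators:
  assumes n: "2 \<le> n" "v \<le> n" and rank: "dim (colvec ` polys n) \<le> n - v + 1"
  shows "\<exists>D t T. D \<le> n \<and> n \<le> D + 1 \<and> t + v \<le> D \<and>
    colvec ` polys t = colvec ` polys D \<and> multiplication_operators D T"
proof -
  define r where "r k = dim (colvec ` polys k)" for k
  have r: "j \<le> k \<Longrightarrow> r j \<le> r k" "1 \<le> r k" for j k
    unfolding r_def by (rule dim_colvec_mono, assumption, rule dim_colvec_pos)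
  show ?thesis
  proof (cases "\<exists>t. t + 1 \<le> n - 1 \<and> t + v \<le> n - 1 \<and> r (t + 1) \<le> r t")
    case True
    then obtain t where t: "t + 1 \<le> n - 1" "t + v \<le> n - 1" "r (t + 1) \<le> r t" by blast
    have "colvec ` polys t = colvec ` polys (t + 1)"
      using t(3) by (intro colvec_polys_eqI) (simp_all add: r_def)
    from colvec_flat_step[OF this, of "n - 1"]
    have flat: "colvec ` polys t = colvec ` polys (n - 1)"
      using t(1) by simp
    have "\<exists>T. multiplication_operators (n - 1) T"
      by (rule flat_multiplication_operators[OF flat t(1)]) arith+
    then obtain T where "multiplication_operators (n - 1) T" by blast
    moreover have "n - 1 \<le> n" "n \<le> n - 1 + 1" by simp_all
    ultimately show ?thesis using flat t(2) by blast
  next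
    case False
    have strict: "r t < r (t + 1)" if "t + 1 \<le> n - 1" "t + v \<le> n - 1" for t
    proof (rule ccontr)
      assume "\<not> r t < r (t + 1)"
      then have "r (t + 1) \<le> r t" by simp
      with False that show False by blast
    qed
    \<comment> \<open>Without an early stall every degree step up to the smaller of
      \<open>n - 1\<close> and \<open>n - v\<close> adds at least one to the rank.\<close>
    have grow: "r j + (k - j) \<le> r k" if "j \<le> k" "k \<le> n - 1" "k \<le> n - v" for j k
      using that
    proof (induction k rule: dec_induct)
      case (step k)
      have "r k < r (k + 1)" using step.prems n by (intro strict) auto
      moreover have "r j + (k - j) \<le> r k" using step.IH step.prems by simp
      ultimately show ?case using step.hyps by simp
    qed simp
    have flat: ?thesis if t: "t + 1 \<le> n" "t + v \<le> n" "r n \<le> r t" for t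
    proof -
      have flat: "colvec ` polys t = colvec ` polys n"
        using t by (intro colvec_polys_eqI) (simp_all add: r_def)
      then obtain T where "multiplication_operators n T"
        using flat_multiplication_operators[OF flat t(1)] by auto
      moreover have "n \<le> n" "n \<le> n + 1" by simp_all
      ultimately show ?thesis using flat t(2) by blast
    qed
    show ?thesis
    proof (cases "v = 0")
      case False
      \<comment> \<open>The rank is already 1 in degree 0, so growth reaches the bound
        \<open>n - v + 1\<close> in degree \<open>n - v\<close>.\<close>
      have "r n \<le> r (n - v)"
        using grow[of 0 "n - v"] r(2)[of 0] rank[folded r_def] False by linarith
      then show ?thesis using flat[of "n - v"] False n by simp
    next
      case True
      show ?thesis
      proof (cases "r n \<le> r (n - 1)")
        case True
        then show ?thesis using flat[of "n - 1"] \<open>v = 0\<close> n by simp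
      next
        case False
        \<comment> \<open>Growth from degree 1 to \<open>n - 1\<close> accounts for
          \<open>n - 2\<close>, which leaves at most 2 for \<open>r 1\<close>. The flatness claim
          then holds trivially with \<open>t = D = n - 1\<close>.\<close>
        then have "r (n - 1) \<le> n" using rank[folded r_def] \<open>v = 0\<close> by linarith
        then have "dim (colvec ` polys 1) \<le> 2"
          using grow[of 1 "n - 1"] \<open>v = 0\<close> n unfolding r_def[symmetric] by linarith
        then obtain T where "multiplication_operators (n - 1) T"
          using line_multiplication_operators n(1) by blast
        moreover have "n - 1 \<le> n" "n \<le> n - 1 + 1" "n - 1 + v \<le> n - 1"
          using \<open>v = 0\<close> by simp_all
        ultimately show ?thesis by blast
      qed
    qed
  qed
qed

end

section \<open>The atoms are feasible\<close>

context moment_psd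
begin

text \<open>An eigenvector \<open>e\<close> has a representative \<open>p\<close> of degree at most
  \<open>t\<close> whose weighted square is 1 at the atom of \<open>e\<close> and 0 at the other
  atoms. Since \<open>t + v \<le> D\<close>, the representation applies to
  \<open>g * (p * p)\<close> and isolates the value of \<open>g\<close> at the atom.\<close>

lemma low_rank_atoms:
  assumes n: "2 \<le> n" "v \<le> n" and rank: "dim (colvec ` polys n) \<le> n - v + 1"
  obtains E :: "'d rpoly set" and w :: "'d rpoly \<Rightarrow> real" and X :: "'d rpoly \<Rightarrow> real ^ 'd" where
    "finite E" "card E \<le> dim (colvec ` polys n)" "\<And>e. e \<in> E \<Longrightarrow> 0 < w e"
    "\<And>p. p \<in> polys (2 * n - 1) \<Longrightarrow> riesz \<phi> p = (\<Sum>e\<in>E. w e * poly_val p (X e))"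
    "\<And>e g. e \<in> E \<Longrightarrow> half_deg g \<le> v \<Longrightarrow>
      (\<And>p. p \<in> polys (n - half_deg g) \<Longrightarrow> 0 \<le> riesz \<phi> (g * (p * p))) \<Longrightarrow>
      0 \<le> poly_val g (X e)"
proof -
  obtain D t T where D: "D \<le> n" "n \<le> D + 1" "t + v \<le> D"
    and flat: "colvec ` polys t = colvec ` polys D" and T: "multiplication_operators D T"
    using low_rank_multiplication_operators[OF n rank] by blast
  have Dn: "p \<in> polys n" if "p \<in> polys D" for p
    using polys_mono[OF D(1) that] .
  obtain E :: "'d rpoly set" and X where E: "finite E" "E \<subseteq> polys D"
      "\<And>e e'. e \<in> E \<Longrightarrow> e' \<in> E \<Longrightarrow> riesz_form \<phi> e e' = (if e = e' then 1 else 0)"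
    and low: "\<And>p e. p \<in> polys D \<Longrightarrow> e \<in> E \<Longrightarrow>
      riesz_form \<phi> p e = poly_val p (X e) * riesz \<phi> e"
    and repr: "\<And>p. p \<in> polys (n + D) \<Longrightarrow> riesz \<phi> p = (\<Sum>e\<in>E. (riesz \<phi> e)\<^sup>2 * poly_val p (X e))"
  proof (rule atomic_representation[where \<phi> = \<phi> and T = T and D = D and n = n])
    show "0 \<le> riesz_form \<phi> p p" if "p \<in> polys D" for p
      using psd Dn that by blast
  qed (use D T in \<open>auto simp: multiplication_operators_def\<close>)
  \<comment> \<open>With \<open>p = e\<close> in \<open>low\<close> the left side is 1, so
    \<open>riesz \<phi> e\<close> cannot vanish.\<close>
  have pos: "0 < (riesz \<phi> e)\<^sup>2" if "e \<in> E" for e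
    using low[of e e] E that by force
  have nonneg: "0 \<le> poly_val g (X e)"
    if e: "e \<in> E" and g: "half_deg g \<le> v"
      and loc: "\<And>p. p \<in> polys (n - half_deg g) \<Longrightarrow> 0 \<le> riesz \<phi> (g * (p * p))" for e g
  proof -
    have "colvec e \<in> colvec ` polys t" using e E(2) flat by blast
    then obtain p where p: "p \<in> polys t" "null (e - p)" by (auto simp: null_diff_iff)
    have pD: "p \<in> polys D" using p(1) D(3) polys_mono[of t D p] by simp
    have interpolate: "(riesz \<phi> e')\<^sup>2 * (poly_val p (X e'))\<^sup>2 = (if e' = e then 1 else 0)"
      if e': "e' \<in> E" for e'
    proof -
      have "riesz_form \<phi> (e - p) e' = 0"
        using p(2) Dn E(2) e' by (auto simp: null_def)
      then have "poly_val p (X e') * riesz \<phi> e' = (if e' = e then 1 else 0)"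
        using low[OF pD e'] E(3)[OF e e'] by (auto simp: B_simps)
      then show ?thesis
        by (metis mult.commute power_mult_distrib one_power2 zero_power2)
    qed
    have "g \<in> polys (2 * half_deg g)"
      by (simp add: polys_tdeg tdeg_le_2_half_deg)
    then have "g * (p * p) \<in> polys (n + D)"
      using polys_mult[OF p(1) p(1)] D g by (intro polys_mult_le[of g _ "p * p" "t + t"]) auto
    then have "riesz \<phi> (g * (p * p)) =
        (\<Sum>e'\<in>E. poly_val g (X e') * ((riesz \<phi> e')\<^sup>2 * (poly_val p (X e'))\<^sup>2))"
      by (simp add: repr poly_val_mult power2_eq_square mult_ac)
    also have "\<dots> = (\<Sum>e'\<in>E. if e' = e then poly_val g (X e) else 0)"
      by (intro sum.cong) (auto simp: interpolate)
    also have "\<dots> = poly_val g (X e)" using e E(1) by simp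
    finally have "riesz \<phi> (g * (p * p)) = poly_val g (X e)" .
    moreover have "p \<in> polys (n - half_deg g)"
      using p(1) D g by (intro polys_mono[of t "n - half_deg g"]) auto
    ultimately show ?thesis using loc by force
  qed
  show thesis
  proof (rule that[OF E(1) card_orthonormal_le_dim pos _ nonneg])
    show "E \<subseteq> polys n" using E(2) Dn by blast
    show "riesz \<phi> p = (\<Sum>e\<in>E. (riesz \<phi> e)\<^sup>2 * poly_val p (X e))" if "p \<in> polys (2 * n - 1)" for p
      using that D n by (intro repr polys_mono[of "2 * n - 1" "n + D" p]) auto
  qed (use E in auto)
qed

lemma rank_on_eq_dim: "rank_on (mindices n) (moment_mat \<phi>) = dim (colvec ` polys n)"
proof -
  have "column_on (mindices n) (moment_mat \<phi>) \<beta> = colvec (mon \<beta>)" for \<beta>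
    by (simp add: column_on_def colvec_def moment_mat_def riesz_form_def flip: mon_add del: mult_single)
  then have "column_on (mindices n) (moment_mat \<phi>) ` mindices n = colvec ` mon ` mindices n"
    by (simp add: image_image)
  then show ?thesis by (simp add: rank_on_def colvec_polys)
qed

end

section \<open>From the relaxation to global minimizers\<close>

lemma relax_feasible_iff:
  "relax_feasible n m g \<phi> \<longleftrightarrow> \<phi> 0 = 1 \<and> (\<forall>p\<in>polys n. 0 \<le> riesz_form \<phi> p p) \<and>
    (\<forall>j\<in>{1..m}. \<forall>p\<in>polys (n - half_deg (g j)). 0 \<le> riesz \<phi> (g j * (p * p)))"
proof -
  have "{0..m} = insert 0 {1..m}" by auto
  then show ?thesis
    by (auto simp: relax_feasible_def localizing_psd_iff riesz_form_def)
qed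

text \<open>At a feasible point the localizing form is \<open>g j\<close> times a square; this makes
  the relaxation a lower bound.\<close>

lemma relax_feasible_dirac:
  assumes "x \<in> feasible_set m g"
  shows "relax_feasible n m g (\<lambda>\<alpha>. monom_val \<alpha> x)"
  using assms
  by (auto simp: relax_feasible_iff riesz_form_def poly_val_mult feasible_set_def
      simp flip: poly_val_eq_riesz)

text \<open>Weights sit on the index set \<open>E\<close> and are pushed forward along
  \<open>X\<close>, so coinciding atoms need no separate treatment.\<close>

lemma represents_point_measure:
  fixes w :: "'a \<Rightarrow> real" and X :: "'a \<Rightarrow> real ^ 'd::finite"
  assumes E: "finite E" and w: "\<And>e. e \<in> E \<Longrightarrow> 0 < w e"
    and repr: "\<And>\<alpha>. \<alpha> \<in> mindices k \<Longrightarrow> \<phi> \<alpha> = (\<Sum>e\<in>E. w e * monom_val \<alpha> (X e))"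
  shows "\<exists>\<mu>. represents \<mu> k \<phi> \<and> supported_on \<mu> (X ` E)"
proof -
  let ?N = "point_measure E (\<lambda>e. ennreal (w e))"
  let ?\<mu> = "distr ?N borel X"
  have X: "X \<in> measurable ?N borel" by simp
  have meas: "monom_val \<alpha> \<in> borel_measurable borel" for \<alpha> :: "'d mindex"
    unfolding monom_val_def by measurable
  have "integrable ?\<mu> (monom_val \<alpha>)" for \<alpha>
    using E by (simp add: integrable_distr_eq[OF X meas] integrable_point_measure_finite)
  moreover have "\<phi> \<alpha> = (\<integral>x. monom_val \<alpha> x \<partial>?\<mu>)" if "\<alpha> \<in> mindices k" for \<alpha>
    using E w repr[OF that]
    by (simp add: integral_distr[OF X meas] lebesgue_integral_point_measure_finite less_imp_le)
  moreover have "supported_on ?\<mu> (X ` E)"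
  proof -
    have "X ` E \<in> sets borel" using E by (intro borel_closed finite_imp_closed) auto
    then have "{x \<in> space borel. x \<in> X ` E} \<in> sets borel" by simp
    then show ?thesis
      unfolding supported_on_def by (subst AE_distr_iff[OF X]) (auto simp: AE_point_measure)
  qed
  ultimately have "represents ?\<mu> k \<phi> \<and> supported_on ?\<mu> (X ` E)"
    by (simp add: represents_def)
  then show ?thesis by blast
qed

theorem theorem7:
  fixes f :: "'d::finite rpoly" and g :: "nat \<Rightarrow> 'd rpoly" and m n v s :: nat
    and \<phi> :: "'d mseq"
  assumes "2 \<le> tdeg f"
    and "v = max_half_deg m g"
    and "v \<le> n"
    and "tdeg f \<le> 2 * n - 1"
    and "relax_optimal n f m g \<phi>"
    and "s = rank_on (mindices n) (moment_mat \<phi>)"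
  shows "(s \<le> n - v + 1 \<longrightarrow>
            ereal (riesz \<phi> f) = opt_value f m g \<and>
            relax_value n f m g = ereal (riesz \<phi> f) \<and>
            relax_exact n f m g \<and>
            (\<exists>\<mu> S. represents \<mu> (2 * n - 1) \<phi> \<and> finite S \<and> card S \<le> s \<and>
                   S \<subseteq> global_minimizers f m g \<and> supported_on \<mu> S))
       \<and> (s \<le> n - v + 1 \<and> tdeg f \<le> 2 \<and> (\<forall>j\<in>{1..m}. tdeg (g j) \<le> 2) \<longrightarrow>
            (\<exists>\<mu>. prob_space \<mu> \<and> sets \<mu> = sets borel \<and>
                 supported_on \<mu> (global_minimizers f m g)))"
proof -
  have feas: "relax_feasible n m g \<phi>"
    and opt: "\<And>\<psi>. relax_feasible n m g \<psi> \<Longrightarrow> riesz \<phi> f \<le> riesz \<psi> f"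
    using assms(5) by (auto simp: relax_optimal_def is_arg_min_linorder)
  interpret moment_psd \<phi> n
    using feas by unfold_locales (auto simp: relax_feasible_iff)
  have s: "s = dim (colvec ` polys n)" by (simp add: assms(6) rank_on_eq_dim)
  have n: "2 \<le> n" using assms(1,4) by linarith
  have lower: "riesz \<phi> f \<le> poly_val f x" if "x \<in> feasible_set m g" for x
    using opt[OF relax_feasible_dirac[OF that]] by (simp add: poly_val_eq_riesz)
  have relax: "relax_value n f m g = ereal (riesz \<phi> f)"
    unfolding relax_value_def using feas opt
    by (intro antisym INF_lower2[of \<phi>] INF_greatest) auto
  have main: "ereal (riesz \<phi> f) = opt_value f m g \<and>
      (\<exists>\<mu> S. represents \<mu> (2 * n - 1) \<phi> \<and> finite S \<and> card S \<le> s \<and>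
        S \<subseteq> global_minimizers f m g \<and> supported_on \<mu> S)" if rank: "s \<le> n - v + 1"
  proof -
    obtain E :: "'d rpoly set" and w X where E: "finite E" "card E \<le> s"
        "\<And>e. e \<in> E \<Longrightarrow> 0 < w e"
      and repr: "\<And>p. p \<in> polys (2 * n - 1) \<Longrightarrow> riesz \<phi> p = (\<Sum>e\<in>E. w e * poly_val p (X e))"
      and loc: "\<And>e g. e \<in> E \<Longrightarrow> half_deg g \<le> v \<Longrightarrow>
        (\<And>p. p \<in> polys (n - half_deg g) \<Longrightarrow> 0 \<le> riesz \<phi> (g * (p * p))) \<Longrightarrow>
        0 \<le> poly_val g (X e)"
      using low_rank_atoms[OF n assms(3) rank[unfolded s]] unfolding s by blast
    have "half_deg (g j) \<le> v" if "j \<in> {1..m}" for j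
      using that unfolding assms(2) max_half_deg_def by (intro Max_ge) auto
    then have XK: "X e \<in> feasible_set m g" if "e \<in> E" for e
      using loc[OF that] feas by (auto simp: feasible_set_def relax_feasible_iff)
    have sum1: "(\<Sum>e\<in>E. w e) = 1"
      using repr[of 1] normalized by simp
    \<comment> \<open>All terms are nonnegative by \<open>lower\<close>, so each of them
      vanishes.\<close>
    have "(\<Sum>e\<in>E. w e * (poly_val f (X e) - riesz \<phi> f)) = 0"
      using repr[of f] assms(4) sum1
      by (simp add: polys_tdeg right_diff_distrib sum_subtractf flip: sum_distrib_right)
    moreover have "0 \<le> w e * (poly_val f (X e) - riesz \<phi> f)" if "e \<in> E" for e
      using E(3)[OF that] lower[OF XK[OF that]] by simp
    ultimately have "w e * (poly_val f (X e) - riesz \<phi> f) = 0" if "e \<in> E" for e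
      using that E(1) by (simp add: sum_nonneg_eq_0_iff)
    then have val: "poly_val f (X e) = riesz \<phi> f" if "e \<in> E" for e
      using E(3)[OF that] that by force
    have min: "X ` E \<subseteq> global_minimizers f m g"
      using XK val lower by (auto simp: global_minimizers_def is_arg_min_linorder)
    \<comment> \<open>Weights summing to 1 force at least one atom, so the feasible set is nonempty
      and the value is attained.\<close>
    obtain e where e: "e \<in> E" using sum1 by fastforce
    have "opt_value f m g = ereal (riesz \<phi> f)"
      unfolding opt_value_def using XK[OF e] val[OF e] lower
      by (intro antisym INF_lower2[of "X e"] INF_greatest) auto
    moreover have "\<exists>\<mu>. represents \<mu> (2 * n - 1) \<phi> \<and> supported_on \<mu> (X ` E)"
    proof (rule represents_point_measure[OF E(1,3)])
      show "\<phi> \<alpha> = (\<Sum>e\<in>E. w e * monom_val \<alpha> (X e))" if "\<alpha> \<in> mindices (2 * n - 1)" for \<alpha>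
        using repr[of "mon \<alpha>"] that by (simp add: mindices_def)
    qed
    moreover have "card (X ` E) \<le> s" using card_image_le[OF E(1), of X] E(2) by linarith
    moreover have "finite (X ` E)" using E(1) by simp
    ultimately show ?thesis using min by metis
  qed
  have "\<exists>\<mu>. prob_space \<mu> \<and> sets \<mu> = sets borel \<and> supported_on \<mu> (global_minimizers f m g)"
    if rank: "s \<le> n - v + 1"
  proof -
    obtain \<mu> S where \<mu>: "represents \<mu> (2 * n - 1) \<phi>" "S \<subseteq> global_minimizers f m g" "supported_on \<mu> S"
      using main[OF rank] by blast
    \<comment> \<open>The total mass is the moment of the constant 1.\<close>
    have "0 \<in> mindices (2 * n - 1)" by (simp add: mindices_def)
    then have "\<phi> 0 = (\<integral>x. monom_val 0 x \<partial>\<mu>)"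
      using \<mu>(1) by (auto simp: represents_def)
    then have mass: "measure \<mu> (space \<mu>) = 1"
      using normalized by simp
    \<comment> \<open>\<open>measure\<close> sends infinite mass to 0, so the value 1 rules it
      out.\<close>
    then have "emeasure \<mu> (space \<mu>) \<noteq> \<infinity>"
      by (auto simp: measure_def)
    then have "prob_space \<mu>"
      using mass by (intro prob_spaceI) (simp add: emeasure_eq_ennreal_measure)
    moreover have "supported_on \<mu> (global_minimizers f m g)"
      using \<mu>(2,3) unfolding supported_on_def by (auto elim: eventually_mono)
    ultimately show ?thesis using \<mu>(1) by (auto simp: represents_def)
  qed
  with main relax show ?thesis by (auto simp: relax_exact_def)
qed

end
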